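(* Let $H=K_{5,5}\setminus C_{10}$ be the (unlabeled) graph obtained from the complete bipartite graph $K_{5,5}$ by deleting the edges of a Hamiltonian cycle $C_{10}$ (on all $10$ vertices), and let $e$ be the (unlabeled) graph consisting of a single edge. Then $H$ is a trivial square, and $H-e^{15}\in\mathcal{A}_\emptyset$ is not a sum of squares (sos). Moreover, there is no sum of squares (sos) $g\in\mathcal{A}_\emptyset$ such that $(H-e^{15})(1+g)$ is a sum of squares (sos).
   Context: All graphs are finite and simple (no loops or multiple edges). A graph is partially labeled if some subset of its vertices (possibly empty, possibly all) carries pairwise distinct labels from $\mathbb{N}=\{1,2,3,\dots\}$, each vertex having at most one label; it is unlabeled if no vertex is labeled and fully labeled if all are. Partially labeled graphs are identified up to label-preserving isomorphism. $\mathcal{A}$ is the real vector space of formal finite $\mathbb{R}$-linear combinations ("graph combinations") of partially labeled graphs without isolated vertices, including the empty graph, denoted $1$. The product $H_1H_2$ of two partially labeled graphs is obtained by taking the disjoint union, identifying vertices carrying the same label, and keeping only one copy of any doubled edge; extended bilinearly, this makes $\mathcal{A}$ a commutative $\mathbb{R}$-algebra with identity $1$. $\mathcal{A}_\emptyset$ is the subalgebra spanned by unlabeled graphs, where the product is disjoint union (so $e^{15}$ is the disjoint union of $15$ edges). The linear map $[[\cdot]]:\mathcal{A}\to\mathcal{A}_\emptyset$ removes all labels. A sum of squares (sos) is an element of $\mathcal{A}_\emptyset$ of the form $\sum_i[[a_i^2]]$, a finite sum with $a_i\in\mathcal{A}$. An unlabeled graph $F$ is a trivial square if whenever $F=[[G^2]]$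 for some partially labeled graph $G$, then $G$ is a fully labeled copy of $F$. *)

theory Defs
  imports Complex_Main "HOL-Library.Poly_Mapping"
begin

text \<open>
  A labeled vertex is identified with its label, so each vertex has at most one label and distinct
  vertices carry distinct labels by construction. Unlabeled vertices have arbitrary names.
\<close>

datatype vertex = Lab nat | Unl nat

fun label :: "vertex \<Rightarrow> nat option" where
  "label (Lab l) = Some l"
| "label (Unl k) = None"

type_synonym graph_rep = "vertex set \<times> vertex set set"

text \<open>Finite simple graphs; the labels are the positive integers.\<close>

definition wf_rep :: "graph_rep \<Rightarrow> bool" where
  "wf_rep G \<longleftrightarrow> finite (fst G) \<and> Lab 0 \<notin> fst G \<and> (\<forall>e\<in>snd G. e \<subseteq> fst G \<and> card e = 2)"

definition map_rep :: "(vertex \<Rightarrow> vertex) \<Rightarrow> graph_rep \<Rightarrow> graph_rep" where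
  "map_rep h G = (h ` fst G, (`) h ` snd G)"

definition iso_rep :: "graph_rep \<Rightarrow> graph_rep \<Rightarrow> bool" where
  "iso_rep G G' \<longleftrightarrow> wf_rep G \<and> wf_rep G' \<and>
    (\<exists>h. inj_on h (fst G) \<and> (\<forall>v\<in>fst G. label (h v) = label v) \<and> G' = map_rep h G)"

fun rename :: "(nat \<Rightarrow> nat) \<Rightarrow> vertex \<Rightarrow> vertex" where
  "rename f (Lab l) = Lab l"
| "rename f (Unl k) = Unl (f k)"

definition union_rep :: "graph_rep \<Rightarrow> graph_rep \<Rightarrow> graph_rep" where
  "union_rep G H = (fst G \<union> fst H, snd G \<union> snd H)"

text \<open>
  The unlabeled vertices of the two factors are renamed apart; the union then identifies vertices
  with equal labels and keeps one copy of every doubled edge.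
\<close>

definition glue_rep :: "graph_rep \<Rightarrow> graph_rep \<Rightarrow> graph_rep" where
  "glue_rep G H =
    union_rep (map_rep (rename (\<lambda>k. 2 * k)) G) (map_rep (rename (\<lambda>k. 2 * k + 1)) H)"

text \<open>Removing labels keeps formerly labeled and unlabeled vertices apart.\<close>

fun drop_label :: "vertex \<Rightarrow> vertex" where
  "drop_label (Lab l) = Unl (2 * l)"
| "drop_label (Unl k) = Unl (2 * k + 1)"

lemma label_eq_Some: "label v = Some l \<longleftrightarrow> v = Lab l"
  by (cases v) auto

lemma label_eq_None: "label v = None \<longleftrightarrow> (\<exists>k. v = Unl k)"
  by (cases v) auto

lemma label_drop_label [simp]: "label (drop_label v) = None"
  by (cases v) auto

lemma label_rename [simp]: "label (rename f v) = label v"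
  by (cases v) auto

lemma rename_comp: "rename f (rename g v) = rename (\<lambda>k. f (g k)) v"
  by (cases v) auto

lemma inj_rename:
  assumes "inj f"
  shows "inj (rename f)"
proof (rule injI)
  fix u v
  assume "rename f u = rename f v"
  then show "u = v"
    using assms by (cases u; cases v) (simp_all add: inj_eq)
qed

lemma inj_drop_label: "inj drop_label"
proof (rule injI)
  fix u v
  assume "drop_label u = drop_label v"
  then show "u = v"
    by (cases u; cases v) (simp_all, presburger+)
qed

lemma map_rep_comp: "map_rep f (map_rep g G) = map_rep (\<lambda>v. f (g v)) G"
  by (simp add: map_rep_def image_image)

lemma map_rep_cong:
  assumes "wf_rep G" "\<And>v. v \<in> fst G \<Longrightarrow> f v = g v"
  shows "map_rep f G = map_rep g G"
proof -
  have "f ` e = g ` e" if "e \<in> snd G" for e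
    using assms that unfolding wf_rep_def by (intro image_cong) auto
  then show ?thesis
    using assms(2) by (auto simp: map_rep_def intro!: image_cong)
qed

lemma map_rep_ident:
  assumes "wf_rep G" "\<And>v. v \<in> fst G \<Longrightarrow> f v = v"
  shows "map_rep f G = G"
  using map_rep_cong[OF assms(1), of f "\<lambda>v. v"] assms(2) by (simp add: map_rep_def)

lemma wf_map_rep:
  assumes "wf_rep G" "inj_on h (fst G)" "Lab 0 \<notin> h ` fst G"
  shows "wf_rep (map_rep h G)"
proof -
  have "card (h ` e) = 2" if "e \<in> snd G" for e
    using assms that unfolding wf_rep_def by (metis card_image inj_on_subset)
  then show ?thesis
    using assms unfolding wf_rep_def map_rep_def by (auto simp: image_iff, blast)
qed

lemma Lab0_image:
  assumes "wf_rep G" "\<forall>v\<in>fst G. label (h v) = label v"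
  shows "Lab 0 \<notin> h ` fst G"
  using assms unfolding wf_rep_def by (metis imageE label.simps(1) label_eq_Some)

lemma wf_map_rep_label:
  assumes "wf_rep G" "inj_on h (fst G)" "\<forall>v\<in>fst G. label (h v) = label v"
  shows "wf_rep (map_rep h G)"
  using assms Lab0_image wf_map_rep by blast

lemma wf_union_rep: "wf_rep G \<Longrightarrow> wf_rep H \<Longrightarrow> wf_rep (union_rep G H)"
  unfolding wf_rep_def union_rep_def by auto

lemma wf_rename: "wf_rep G \<Longrightarrow> inj f \<Longrightarrow> wf_rep (map_rep (rename f) G)"
  by (rule wf_map_rep_label) (auto intro: inj_on_subset inj_rename)

lemma inj_double: "inj (\<lambda>k::nat. 2 * k)" "inj (\<lambda>k::nat. 2 * k + 1)"
  by (auto intro!: injI)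

lemma wf_glue_rep: "wf_rep G \<Longrightarrow> wf_rep H \<Longrightarrow> wf_rep (glue_rep G H)"
  unfolding glue_rep_def using wf_union_rep wf_rename inj_double by blast

lemma iso_repI:
  assumes "wf_rep G" "inj_on h (fst G)" "\<forall>v\<in>fst G. label (h v) = label v"
  shows "iso_rep G (map_rep h G)"
  using assms wf_map_rep_label unfolding iso_rep_def by blast

lemma iso_rep_refl: "wf_rep G \<Longrightarrow> iso_rep G G"
  using iso_repI[of G "\<lambda>v. v"] map_rep_ident[of G "\<lambda>v. v"] by simp

lemma iso_rep_sym:
  assumes "iso_rep G H"
  shows "iso_rep H G"
proof -
  obtain h where h: "wf_rep G" "wf_rep H" "inj_on h (fst G)"
      "\<forall>v\<in>fst G. label (h v) = label v" "H = map_rep h G"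
    using assms unfolding iso_rep_def by auto
  let ?g = "inv_into (fst G) h"
  have V: "fst H = h ` fst G"
    by (simp add: h(5) map_rep_def)
  have "map_rep ?g H = G"
    unfolding h(5) map_rep_comp by (rule map_rep_ident[OF h(1)]) (simp add: h(3))
  moreover have "inj_on ?g (fst H)"
    unfolding V by (rule inj_on_inv_into) simp
  moreover have "\<forall>v\<in>fst H. label (?g v) = label v"
    unfolding V using h(3,4) by auto
  ultimately show ?thesis
    using h(1,2) unfolding iso_rep_def by metis
qed

lemma iso_rep_trans:
  assumes "iso_rep G H" "iso_rep H K"
  shows "iso_rep G K"
proof -
  obtain f where f: "wf_rep G" "inj_on f (fst G)" "\<forall>v\<in>fst G. label (f v) = label v"
      "H = map_rep f G"
    using assms(1) unfolding iso_rep_def by auto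
  obtain g where g: "wf_rep K" "inj_on g (fst H)" "\<forall>v\<in>fst H. label (g v) = label v"
      "K = map_rep g H"
    using assms(2) unfolding iso_rep_def by auto
  have V: "fst H = f ` fst G"
    by (simp add: f(4) map_rep_def)
  have "K = map_rep (\<lambda>v. g (f v)) G"
    by (simp add: f(4) g(4) map_rep_comp)
  moreover have "inj_on (\<lambda>v. g (f v)) (fst G)"
    using f(2) g(2) comp_inj_on[of f "fst G" g] unfolding V by (simp add: comp_def)
  moreover have "\<forall>v\<in>fst G. label (g (f v)) = label v"
    using f(3) g(3) unfolding V by auto
  ultimately show ?thesis
    using f(1) g(1) unfolding iso_rep_def by metis
qed

lemma part_equivp_iso_rep: "part_equivp iso_rep"
proof (rule part_equivpI)
  show "\<exists>x. iso_rep x x"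
    by (rule exI[of _ "({}, {})"]) (rule iso_rep_refl, simp add: wf_rep_def)
  show "symp iso_rep"
    by (rule sympI) (rule iso_rep_sym)
  show "transp iso_rep"
    by (rule transpI) (rule iso_rep_trans)
qed

lemma map_rep_union: "map_rep h (union_rep G H) = union_rep (map_rep h G) (map_rep h H)"
  by (simp add: map_rep_def union_rep_def image_Un)

lemma iso_glue_repI:
  assumes G: "wf_rep G" "inj_on a (fst G)" "\<forall>v\<in>fst G. label (a v) = label v"
    and H: "wf_rep H" "inj_on b (fst H)" "\<forall>v\<in>fst H. label (b v) = label v"
    and disj: "\<And>j k. Unl j \<in> fst G \<Longrightarrow> Unl k \<in> fst H \<Longrightarrow> a (Unl j) \<noteq> b (Unl k)"
  shows "iso_rep (glue_rep G H) (union_rep (map_rep a G) (map_rep b H))"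
proof -
  define p where "p v = (case v of Lab l \<Rightarrow> Lab l
    | Unl n \<Rightarrow> if even n then a (Unl (n div 2)) else b (Unl (n div 2)))" for v
  have pa: "p (rename (\<lambda>k. 2 * k) v) = a v" if "v \<in> fst G" for v
    using that G(3) by (cases v) (auto simp: p_def label_eq_Some)
  have pb: "p (rename (\<lambda>k. 2 * k + 1) v) = b v" if "v \<in> fst H" for v
    using that H(3) by (cases v) (auto simp: p_def label_eq_Some)
  have V: "fst (glue_rep G H) = rename (\<lambda>k. 2 * k) ` fst G \<union> rename (\<lambda>k. 2 * k + 1) ` fst H"
    by (simp add: glue_rep_def union_rep_def map_rep_def)
  have lab: "\<forall>v\<in>fst (glue_rep G H). label (p v) = label v"
    unfolding V using pa pb G(3) H(3) by auto
  have cross: "rename (\<lambda>k. 2 * k) u = rename (\<lambda>k. 2 * k + 1) v"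
    if "u \<in> fst G" "v \<in> fst H" "a u = b v" for u v
  proof -
    have "label u = label v"
      using that G(3) H(3) by metis
    then show ?thesis
      using that disj by (cases u; cases v) auto
  qed
  have inj: "inj_on p (fst (glue_rep G H))"
    unfolding V
  proof (rule inj_onI, elim UnE imageE)
    fix x y u v
    assume "p x = p y" "x = rename (\<lambda>k. 2 * k) u" "u \<in> fst G" "y = rename (\<lambda>k. 2 * k) v" "v \<in> fst G"
    then show "x = y"
      using pa G(2) by (metis inj_onD)
  next
    fix x y u v
    assume "p x = p y" "x = rename (\<lambda>k. 2 * k) u" "u \<in> fst G"
      "y = rename (\<lambda>k. 2 * k + 1) v" "v \<in> fst H"
    then show "x = y"
      using pa pb cross by metis
  next
    fix x y u v
    assume "p x = p y" "x = rename (\<lambda>k. 2 * k + 1) u" "u \<in> fst H"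
      "y = rename (\<lambda>k. 2 * k) v" "v \<in> fst G"
    then show "x = y"
      using pa pb cross by metis
  next
    fix x y u v
    assume "p x = p y" "x = rename (\<lambda>k. 2 * k + 1) u" "u \<in> fst H"
      "y = rename (\<lambda>k. 2 * k + 1) v" "v \<in> fst H"
    then show "x = y"
      using pb H(2) by (metis inj_onD)
  qed
  have "map_rep p (glue_rep G H) = union_rep (map_rep a G) (map_rep b H)"
    unfolding glue_rep_def map_rep_union map_rep_comp
    using map_rep_cong[OF G(1) pa] map_rep_cong[OF H(1) pb] by simp
  then show ?thesis
    using iso_repI[OF wf_glue_rep[OF G(1) H(1)] inj lab] by simp
qed

lemma iso_glue_rep:
  assumes "iso_rep G G'" "iso_rep H H'"
  shows "iso_rep (glue_rep G H) (glue_rep G' H')"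
proof -
  obtain f where f: "wf_rep G" "inj_on f (fst G)" "\<forall>v\<in>fst G. label (f v) = label v"
      "G' = map_rep f G"
    using assms(1) unfolding iso_rep_def by auto
  obtain g where g: "wf_rep H" "inj_on g (fst H)" "\<forall>v\<in>fst H. label (g v) = label v"
      "H' = map_rep g H"
    using assms(2) unfolding iso_rep_def by auto
  have "iso_rep (glue_rep G H) (union_rep (map_rep (\<lambda>v. rename (\<lambda>k. 2 * k) (f v)) G)
      (map_rep (\<lambda>v. rename (\<lambda>k. 2 * k + 1) (g v)) H))"
  proof (rule iso_glue_repI)
    show "inj_on (\<lambda>v. rename (\<lambda>k. 2 * k) (f v)) (fst G)"
      using f(2) inj_rename[OF inj_double(1)] by (auto simp: inj_on_def)
    show "inj_on (\<lambda>v. rename (\<lambda>k. 2 * k + 1) (g v)) (fst H)"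
      using g(2) inj_rename[OF inj_double(2)] by (auto simp: inj_on_def)
    fix j k
    assume "Unl j \<in> fst G" "Unl k \<in> fst H"
    then have "label (f (Unl j)) = None" "label (g (Unl k)) = None"
      using f(3) g(3) by auto
    then obtain m n where mn: "f (Unl j) = Unl m" "g (Unl k) = Unl n"
      by (auto simp: label_eq_None)
    show "rename (\<lambda>k. 2 * k) (f (Unl j)) \<noteq> rename (\<lambda>k. 2 * k + 1) (g (Unl k))"
      unfolding mn by simp presburger
  qed (use f g in auto)
  then show ?thesis
    by (simp add: glue_rep_def f(4) g(4) map_rep_comp)
qed

lemma iso_glue_rep_commute:
  assumes "wf_rep G" "wf_rep H"
  shows "iso_rep (glue_rep G H) (glue_rep H G)"
proof -
  have "iso_rep (glue_rep G H)
      (union_rep (map_rep (rename (\<lambda>k. 2 * k + 1)) G) (map_rep (rename (\<lambda>k. 2 * k)) H))"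
  proof (rule iso_glue_repI)
    show "inj_on (rename (\<lambda>k. 2 * k + 1)) (fst G)" "inj_on (rename (\<lambda>k. 2 * k)) (fst H)"
      using inj_rename inj_double inj_on_subset by blast+
    show "rename (\<lambda>k. 2 * k + 1) (Unl i) \<noteq> rename (\<lambda>k. 2 * k) (Unl j)" for i j
      by simp presburger
  qed (use assms in auto)
  then show ?thesis
    by (simp add: glue_rep_def union_rep_def Un_commute)
qed

lemma iso_glue_rep_assoc:
  assumes "wf_rep A" "wf_rep B" "wf_rep C"
  shows "iso_rep (glue_rep (glue_rep A B) C) (glue_rep A (glue_rep B C))"
proof -
  define f where "f k = (if even k then k else 2 * k - 1)" for k :: nat
  have f: "inj f"
    by (rule injI) (auto simp: f_def split: if_splits; presburger)
  have f0: "(\<lambda>k. f (2 * k)) = (\<lambda>k. 2 * k)" and f1: "(\<lambda>k. f (2 * k + 1)) = (\<lambda>k. 2 * (2 * k) + 1)"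
    by (auto simp: f_def)
  have "iso_rep (glue_rep (glue_rep A B) C)
      (union_rep (map_rep (rename f) (glue_rep A B)) (map_rep (rename (\<lambda>k. 2 * (2 * k + 1) + 1)) C))"
  proof (rule iso_glue_repI)
    show "inj_on (rename f) (fst (glue_rep A B))"
      using inj_rename[OF f] inj_on_subset by blast
    have "inj (\<lambda>k::nat. 2 * (2 * k + 1) + 1)"
      by (auto intro: injI)
    then show "inj_on (rename (\<lambda>k. 2 * (2 * k + 1) + 1)) (fst C)"
      using inj_rename inj_on_subset by blast
    show "rename f (Unl i) \<noteq> rename (\<lambda>k. 2 * (2 * k + 1) + 1) (Unl j)" for i j
      by (simp add: f_def) presburger
  qed (use assms wf_glue_rep in auto)
  also have "map_rep (rename f) (glue_rep A B) =
      union_rep (map_rep (rename (\<lambda>k. 2 * k)) A) (map_rep (rename (\<lambda>k. 2 * (2 * k) + 1)) B)"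
    by (simp only: glue_rep_def map_rep_union map_rep_comp rename_comp f0 f1)
  also have "union_rep \<dots> (map_rep (rename (\<lambda>k. 2 * (2 * k + 1) + 1)) C) =
      glue_rep A (glue_rep B C)"
    by (simp only: glue_rep_def map_rep_union map_rep_comp rename_comp)
      (simp add: union_rep_def Un_assoc)
  finally show ?thesis .
qed

lemma iso_glue_rep_empty:
  assumes "wf_rep G"
  shows "iso_rep (glue_rep ({}, {}) G) G"
proof -
  have "iso_rep (glue_rep ({}, {}) G) (union_rep (map_rep (\<lambda>v. v) ({}, {})) (map_rep (\<lambda>v. v) G))"
    by (rule iso_glue_repI) (use assms in \<open>auto simp: wf_rep_def\<close>)
  then show ?thesis
    by (simp add: union_rep_def map_rep_def)
qed

lemma wf_drop_label: "wf_rep G \<Longrightarrow> wf_rep (map_rep drop_label G)"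
  by (rule wf_map_rep)
    (auto intro: inj_on_subset[OF inj_drop_label],
      metis label_drop_label label.simps(1) option.distinct(1))

lemma iso_drop_label:
  assumes "iso_rep G G'"
  shows "iso_rep (map_rep drop_label G) (map_rep drop_label G')"
proof -
  obtain f where f: "wf_rep G" "inj_on f (fst G)" "\<forall>v\<in>fst G. label (f v) = label v"
      "G' = map_rep f G"
    using assms unfolding iso_rep_def by auto
  define h where "h v = drop_label (f (inv drop_label v))" for v
  have V: "fst (map_rep drop_label G) = drop_label ` fst G"
    by (simp add: map_rep_def)
  have "iso_rep (map_rep drop_label G) (map_rep h (map_rep drop_label G))"
  proof (rule iso_repI)
    show "wf_rep (map_rep drop_label G)"
      using f(1) by (rule wf_drop_label)
    show "inj_on h (fst (map_rep drop_label G))"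
      unfolding V using f(2) inj_drop_label
      by (auto simp: inj_on_def h_def inv_f_f)
    show "\<forall>v\<in>fst (map_rep drop_label G). label (h v) = label v"
      unfolding V h_def by auto
  qed
  also have "map_rep h (map_rep drop_label G) = map_rep drop_label G'"
    by (simp add: f(4) map_rep_comp h_def inv_f_f[OF inj_drop_label])
  finally show ?thesis .
qed

quotient_type plgraph = graph_rep / partial: iso_rep
  by (rule part_equivp_iso_rep)

text \<open>
  Exponents of \<^typ>\<open>'a \<Rightarrow>\<^sub>0 'b\<close> are written additively, so the product of partially labeled
  graphs is \<open>+\<close> and the empty graph is \<open>0\<close>; in the algebra they become \<open>*\<close> and \<open>1\<close>.
\<close>

instantiation plgraph :: comm_monoid_add
begin

lift_definition zero_plgraph :: plgraph is "({}, {})"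
  by (rule iso_rep_refl) (simp add: wf_rep_def)

lift_definition plus_plgraph :: "plgraph \<Rightarrow> plgraph \<Rightarrow> plgraph" is glue_rep
  by (rule iso_glue_rep)

instance
proof
  fix a b c :: plgraph
  show "a + b + c = a + (b + c)"
    by transfer (rule iso_glue_rep_assoc; simp add: iso_rep_def)
  show "a + b = b + a"
    by transfer (rule iso_glue_rep_commute; simp add: iso_rep_def)
  show "0 + a = a"
    by transfer (rule iso_glue_rep_empty; simp add: iso_rep_def)
qed

end

lift_definition remove_labels :: "plgraph \<Rightarrow> plgraph" is "map_rep drop_label"
  by (rule iso_drop_label)

lift_definition unlabeled :: "plgraph \<Rightarrow> bool" is
  "\<lambda>G. \<forall>v\<in>fst G. label v = None"
  by (force simp: iso_rep_def map_rep_def)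

lift_definition fully_labeled :: "plgraph \<Rightarrow> bool" is
  "\<lambda>G. \<forall>v\<in>fst G. label v \<noteq> None"
  by (force simp: iso_rep_def map_rep_def)

lift_definition no_isolated :: "plgraph \<Rightarrow> bool" is
  "\<lambda>G. \<forall>v\<in>fst G. \<exists>e\<in>snd G. v \<in> e"
proof -
  have "\<forall>v\<in>fst H. \<exists>e\<in>snd H. v \<in> e"
    if "iso_rep G H" "\<forall>v\<in>fst G. \<exists>e\<in>snd G. v \<in> e" for G H
    using that by (fastforce simp: iso_rep_def map_rep_def)
  then show "(\<forall>v\<in>fst G. \<exists>e\<in>snd G. v \<in> e) = (\<forall>v\<in>fst H. \<exists>e\<in>snd H. v \<in> e)"
    if "iso_rep G H" for G H
    using that iso_rep_sym by blast
qed

text \<open>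
  The algebra of all graph combinations, isolated vertices allowed, is the monoid algebra
  \<^typ>\<open>plgraph \<Rightarrow>\<^sub>0 real\<close>; the paper's \<open>\<A>\<close> and \<open>\<A>\<^sub>\<emptyset>\<close> are subsets of it.
\<close>

type_synonym graph_comb = "plgraph \<Rightarrow>\<^sub>0 real"

definition combs :: "graph_comb set" where
  "combs = {a. \<forall>G\<in>Poly_Mapping.keys a. no_isolated G}"

definition unlabeled_combs :: "graph_comb set" where
  "unlabeled_combs = {a \<in> combs. \<forall>G\<in>Poly_Mapping.keys a. unlabeled G}"

definition of_graph :: "plgraph \<Rightarrow> graph_comb" where
  "of_graph G = Poly_Mapping.single G 1"

definition unlabel :: "graph_comb \<Rightarrow> graph_comb" where
  "unlabel a = (\<Sum>G\<in>Poly_Mapping.keys a.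
     Poly_Mapping.single (remove_labels G) (Poly_Mapping.lookup a G))"

definition is_sos :: "graph_comb \<Rightarrow> bool" where
  "is_sos f \<longleftrightarrow> (\<exists>as. set as \<subseteq> combs \<and> f = (\<Sum>a\<leftarrow>as. unlabel (a\<^sup>2)))"

definition trivial_square :: "plgraph \<Rightarrow> bool" where
  "trivial_square F \<longleftrightarrow> unlabeled F \<and>
     (\<forall>G. F = remove_labels (G + G) \<longrightarrow> fully_labeled G \<and> remove_labels G = F)"

lift_definition edge_graph :: plgraph is
  "({Unl 0, Unl 1}, {{Unl 0, Unl 1}})"
  by (rule iso_rep_refl) (simp add: wf_rep_def)

definition K55_edges :: "vertex set set" where
  "K55_edges = {{Unl i, Unl j} | i j. i < 10 \<and> j < 10 \<and> even i \<and> odd j}"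

definition C10_edges :: "vertex set set" where
  "C10_edges = {{Unl i, Unl ((i + 1) mod 10)} | i. i < 10}"

text \<open>
  Up to isomorphism \<open>K\<^sub>5\<^sub>,\<^sub>5\<close> has only one Hamiltonian cycle, so fixing one is no restriction.
\<close>

lift_definition K55_minus_C10 :: plgraph is
  "(Unl ` {..<10}, K55_edges - C10_edges)"
proof (rule iso_rep_refl)
  have "e \<subseteq> Unl ` {..<10} \<and> card e = 2" if "e \<in> K55_edges" for e
    using that by (auto simp: K55_edges_def card_2_iff)
  then show "wf_rep (Unl ` {..<10}, K55_edges - C10_edges)"
    by (auto simp: wf_rep_def)
qed

end

theory Submission
  imports Defs "HOL-Library.FuncSet"
begin

text \<open>
  Write \<open>GK\<close> for the product of two partially labeled graphs. The number of edges of \<open>GK\<close> is at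
  least the average of those of \<open>G\<^sup>2\<close> and \<open>K\<^sup>2\<close>, with equality only if \<open>G\<close> and \<open>K\<close> have the same edges
  between labeled vertices; likewise for vertices. If both are equalities, then for homomorphism
  counts the inequality goes the other way by Cauchy-Schwarz, and Lovasz's theorem makes it strict
  for some target unless \<open>G = K\<close>. Now let \<open>f\<close> be a sum of squares whose terms with at most
  as many edges as the trivial square \<open>H\<close> have nonpositive coefficients, except for \<open>H\<close>. Among all
  \<open>G\<close> occurring in the squares with \<open>G\<^sup>2\<close> of at most that many edges and different from \<open>H\<close>, choose
  one with fewest edges in \<open>G\<^sup>2\<close>, then fewest vertices, then most homomorphisms. By strictness
  \<open>G\<^sup>2\<close> cannot be a product of two different graphs, so its coefficient in \<open>f\<close> is positive, which is
  impossible. Hence there is no such \<open>G\<close>, and the only low term of \<open>f\<close> is \<open>H\<close>. The part of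
  \<open>(H - e\<^sup>1\<^sup>5)(1 + g)\<close> with at most 15 edges is a positive multiple of \<open>H - e\<^sup>1\<^sup>5\<close>.
\<close>

subsection \<open>Homomorphism counts\<close>

text \<open>The pair \<open>S\<close>, \<open>A\<close> is the target. It need not be a well-formed
  graph: \<open>A\<close> may contain singletons, so an edge may collapse, and \<open>A\<close> can
  be kept while \<open>S\<close> shrinks, which yields the induced subtargets needed for
  inclusion-exclusion.\<close>

definition homs :: "vertex set \<Rightarrow> vertex set set \<Rightarrow> graph_rep \<Rightarrow> (vertex \<Rightarrow> vertex) set" where
  "homs S A G = {\<phi> \<in> fst G \<rightarrow>\<^sub>E S. \<forall>e\<in>snd G. \<phi> ` e \<in> A}"

definition labeled :: "graph_rep \<Rightarrow> vertex set" where
  "labeled G = {v \<in> fst G. label v \<noteq> None}"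

definition labeled_edges :: "graph_rep \<Rightarrow> vertex set set" where
  "labeled_edges G = {e \<in> snd G. e \<subseteq> labeled G}"

text \<open>Grouping homomorphisms by their restriction \<open>x\<close> to \<open>T\<close>,
  usually the labeled vertices, turns counts on glued graphs into inner products indexed by
  \<open>x\<close>.\<close>

definition extensions :: "vertex set \<Rightarrow> vertex set set \<Rightarrow> (vertex \<Rightarrow> vertex) \<Rightarrow> vertex set
    \<Rightarrow> graph_rep \<Rightarrow> (vertex \<Rightarrow> vertex) set" where
  "extensions S A x T G = {\<phi> \<in> homs S A G. restrict \<phi> T = x}"

lemma finite_vertices: "wf_rep G \<Longrightarrow> finite (fst G)"
  by (simp add: wf_rep_def)

lemma edge_subset: "wf_rep G \<Longrightarrow> e \<in> snd G \<Longrightarrow> e \<subseteq> fst G"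
  by (simp add: wf_rep_def)

lemma finite_edges: "wf_rep G \<Longrightarrow> finite (snd G)"
  by (rule finite_subset[of _ "Pow (fst G)"]) (auto simp: wf_rep_def)

lemma finite_homs: "wf_rep G \<Longrightarrow> finite S \<Longrightarrow> finite (homs S A G)"
  unfolding homs_def by (rule finite_subset[OF _ finite_PiE[of "fst G" "\<lambda>_. S"]])
    (auto simp: finite_vertices)

lemma finite_extensions: "wf_rep G \<Longrightarrow> finite S \<Longrightarrow> finite (extensions S A x T G)"
  unfolding extensions_def by (simp add: finite_homs)

lemma card_fst_map_rep: "inj_on h (fst G) \<Longrightarrow> card (fst (map_rep h G)) = card (fst G)"
  by (simp add: map_rep_def card_image)

lemma inj_on_image_edges:
  assumes "wf_rep G" "inj_on h (fst G)"
  shows "inj_on ((`) h) (snd G)"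
  using assms inj_on_image_eq_iff[OF assms(2)] by (auto simp: inj_on_def wf_rep_def)

lemma card_snd_map_rep:
  assumes "wf_rep G" "inj_on h (fst G)"
  shows "card (snd (map_rep h G)) = card (snd G)"
  using card_image[OF inj_on_image_edges[OF assms]] by (simp add: map_rep_def)

text \<open>The inverse is precomposition with the inverse of \<open>h\<close> on its image. As
  \<open>h\<close> fixes \<open>T\<close> pointwise, both directions keep the prescribed values on
  \<open>T\<close>.\<close>

lemma bij_betw_extensions_map_rep:
  assumes G: "wf_rep G" and h: "inj_on h (fst G)" and T: "T \<subseteq> fst G" "\<And>v. v \<in> T \<Longrightarrow> h v = v"
  shows "bij_betw (\<lambda>\<phi>. restrict (\<lambda>v. \<phi> (h v)) (fst G))
    (extensions S A x T (map_rep h G)) (extensions S A x T G)"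
proof -
  let ?V = "fst G" and ?g = "inv_into (fst G) h"
  have im: "(restrict (\<lambda>v. \<phi> (h v)) ?V) ` e = \<phi> ` (h ` e)" if "e \<in> snd G" for \<phi> :: "vertex \<Rightarrow> vertex" and e
    using edge_subset[OF G that] by (auto simp: image_image intro!: image_cong)
  have im2: "(restrict (\<lambda>v. \<phi> (?g v)) (h ` ?V)) ` (h ` e) = \<phi> ` e" if "e \<in> snd G" for \<phi> :: "vertex \<Rightarrow> vertex" and e
    using edge_subset[OF G that] h unfolding image_image
    by (intro image_cong) (auto simp: subset_iff)
  have T': "\<And>v. v \<in> T \<Longrightarrow> ?g v = v" "\<And>v. v \<in> T \<Longrightarrow> v \<in> h ` ?V"
    using T h by (metis inv_into_f_f subsetD) (metis T image_eqI subsetD)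
  show ?thesis
  proof (rule bij_betw_byWitness[where f' = "\<lambda>\<phi>. restrict (\<lambda>v. \<phi> (?g v)) (h ` ?V)"])
    show "\<forall>\<phi>\<in>extensions S A x T (map_rep h G).
        restrict (\<lambda>v. restrict (\<lambda>v. \<phi> (h v)) ?V (?g v)) (h ` ?V) = \<phi>"
      using h by (auto simp: extensions_def homs_def map_rep_def fun_eq_iff PiE_def extensional_def restrict_def)
    show "\<forall>\<phi>\<in>extensions S A x T G.
        restrict (\<lambda>v. restrict (\<lambda>v. \<phi> (?g v)) (h ` ?V) (h v)) ?V = \<phi>"
      using h by (auto simp: extensions_def homs_def map_rep_def fun_eq_iff PiE_def extensional_def restrict_def)
    have "restrict (restrict (\<lambda>v. \<phi> (h v)) ?V) T = restrict \<phi> T" for \<phi> :: "vertex \<Rightarrow> vertex"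
      using T by (auto simp: fun_eq_iff restrict_def)
    moreover have "\<forall>e\<in>snd G. restrict (\<lambda>v. \<phi> (h v)) ?V ` e \<in> A" if "\<forall>e\<in>snd G. \<phi> ` h ` e \<in> A"
      for \<phi> :: "vertex \<Rightarrow> vertex"
      using that im by metis
    ultimately show "(\<lambda>\<phi>. restrict (\<lambda>v. \<phi> (h v)) ?V) ` extensions S A x T (map_rep h G) \<subseteq> extensions S A x T G"
      by (auto simp: extensions_def homs_def map_rep_def)
    have "restrict (restrict (\<lambda>v. \<phi> (?g v)) (h ` ?V)) T = restrict \<phi> T" for \<phi> :: "vertex \<Rightarrow> vertex"
      using T' by (auto simp: fun_eq_iff restrict_def)
    moreover have "\<forall>e\<in>snd G. restrict (\<lambda>v. \<phi> (?g v)) (h ` ?V) ` h ` e \<in> A" if "\<forall>e\<in>snd G. \<phi> ` e \<in> A"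
      for \<phi> :: "vertex \<Rightarrow> vertex"
      using that im2 by metis
    ultimately show "(\<lambda>\<phi>. restrict (\<lambda>v. \<phi> (?g v)) (h ` ?V)) ` extensions S A x T G
        \<subseteq> extensions S A x T (map_rep h G)"
      using h by (auto simp: extensions_def homs_def map_rep_def)
  qed
qed

lemma card_extensions_map_rep:
  assumes "wf_rep G" "inj_on h (fst G)" "T \<subseteq> fst G" "\<And>v. v \<in> T \<Longrightarrow> h v = v"
  shows "card (extensions S A x T (map_rep h G)) = card (extensions S A x T G)"
  using bij_betw_same_card[OF bij_betw_extensions_map_rep[OF assms]] by blast

lemma extensions_empty: "extensions S A (\<lambda>_. undefined) {} G = homs S A G"
  by (auto simp: extensions_def)

lemma card_homs_map_rep:
  assumes "wf_rep G" "inj_on h (fst G)"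
  shows "card (homs S A (map_rep h G)) = card (homs S A G)"
  using card_extensions_map_rep[OF assms, of "{}" S A "\<lambda>_. undefined"]
  by (simp add: extensions_empty)

text \<open>A homomorphism of the union is a pair of homomorphisms that agree on the common
  vertices; sorting the pairs by their common restriction gives the sum.\<close>

lemma card_homs_union_rep:
  assumes G: "wf_rep G" and H: "wf_rep H" and S: "finite S"
    and T: "fst G \<inter> fst H = T"
  shows "card (homs S A (union_rep G H)) =
    (\<Sum>x\<in>T \<rightarrow>\<^sub>E S. card (extensions S A x T G) * card (extensions S A x T H))"
proof -
  let ?P = "SIGMA x:T \<rightarrow>\<^sub>E S. extensions S A x T G \<times> extensions S A x T H"
  let ?f = "\<lambda>\<phi>. (restrict \<phi> T, restrict \<phi> (fst G), restrict \<phi> (fst H))"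
  \<comment> \<open>On the overlap \<open>a\<close> and \<open>b\<close> agree, so preferring
    \<open>a\<close> there loses nothing.\<close>
  let ?g = "\<lambda>(x, a, b). \<lambda>v. if v \<in> fst G then a v else b v"
  have imG: "restrict \<phi> (fst G) ` e = \<phi> ` e" if "e \<in> snd G" for \<phi> :: "vertex \<Rightarrow> vertex" and e
    using edge_subset[OF G that] by (intro image_cong) auto
  have imH: "restrict \<phi> (fst H) ` e = \<phi> ` e" if "e \<in> snd H" for \<phi> :: "vertex \<Rightarrow> vertex" and e
    using edge_subset[OF H that] by (intro image_cong) auto
  have agree: "a v = b v" if "restrict a T = x" "restrict b T = x" "v \<in> fst G" "v \<in> fst H"
    for a b x :: "vertex \<Rightarrow> vertex" and v
    using that T by (metis IntI restrict_apply')
  have "bij_betw ?f (homs S A (union_rep G H)) ?P"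
  proof (rule bij_betw_byWitness[where f' = ?g])
    show "\<forall>\<phi>\<in>homs S A (union_rep G H). ?g (?f \<phi>) = \<phi>"
      by (auto simp: homs_def union_rep_def fun_eq_iff PiE_def extensional_def)
    show "\<forall>p\<in>?P. ?f (?g p) = p"
    proof
      fix p
      assume "p \<in> ?P"
      then obtain x a b where p: "p = (x, a, b)"
        and *: "x \<in> T \<rightarrow>\<^sub>E S" "a \<in> extensions S A x T G" "b \<in> extensions S A x T H"
        by auto
      then have r: "restrict a T = x" "restrict b T = x" and e: "a \<in> extensional (fst G)" "b \<in> extensional (fst H)"
        by (auto simp: extensions_def homs_def PiE_def)
      have "restrict (\<lambda>v. if v \<in> fst G then a v else b v) T = x"
        using T r(1) by (auto simp: restrict_def)
      moreover have "restrict (\<lambda>v. if v \<in> fst G then a v else b v) (fst G) = a"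
        using e by (auto simp: restrict_def extensional_def fun_eq_iff)
      moreover have "restrict (\<lambda>v. if v \<in> fst G then a v else b v) (fst H) = b"
        using e agree[OF r] by (auto simp: restrict_def extensional_def fun_eq_iff)
      ultimately show "?f (?g p) = p"
        by (simp only: p prod.case)
    qed
    show "?f ` homs S A (union_rep G H) \<subseteq> ?P"
    proof (rule image_subsetI)
      fix \<phi>
      assume "\<phi> \<in> homs S A (union_rep G H)"
      then have *: "\<phi> \<in> fst G \<union> fst H \<rightarrow>\<^sub>E S" "\<And>e. e \<in> snd G \<or> e \<in> snd H \<Longrightarrow> \<phi> ` e \<in> A"
        by (auto simp: homs_def union_rep_def)
      have "\<forall>e\<in>snd G. restrict \<phi> (fst G) ` e \<in> A" "\<forall>e\<in>snd H. restrict \<phi> (fst H) ` e \<in> A"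
        using *(2) imG imH by metis+
      then have "restrict \<phi> (fst G) \<in> homs S A G" "restrict \<phi> (fst H) \<in> homs S A H"
        using *(1) by (auto simp: homs_def)
      moreover have "restrict (restrict \<phi> (fst G)) T = restrict \<phi> T"
        "restrict (restrict \<phi> (fst H)) T = restrict \<phi> T"
        using T by (auto simp: restrict_def)
      moreover have "restrict \<phi> T \<in> T \<rightarrow>\<^sub>E S"
        using * T by auto
      ultimately show "?f \<phi> \<in> ?P"
        by (simp add: extensions_def)
    qed
    show "?g ` ?P \<subseteq> homs S A (union_rep G H)"
    proof (rule image_subsetI)
      fix p
      assume "p \<in> ?P"
      then obtain x a b where p: "p = (x, a, b)"
        and *: "x \<in> T \<rightarrow>\<^sub>E S" "a \<in> extensions S A x T G" "b \<in> extensions S A x T H"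
        by auto
      then have x: "restrict a T = x" "restrict b T = x"
        and ab: "a \<in> homs S A G" "b \<in> homs S A H"
        by (auto simp: extensions_def)
      have "?g (x, a, b) ` e = a ` e" if "e \<in> snd G" for e
        using edge_subset[OF G that] by (intro image_cong) auto
      moreover have "?g (x, a, b) ` e = b ` e" if "e \<in> snd H" for e
        using edge_subset[OF H that] agree[OF x] by (intro image_cong) auto
      ultimately show "?g p \<in> homs S A (union_rep G H)"
        using ab unfolding p by (auto simp: homs_def union_rep_def PiE_def extensional_def Pi_iff)
    qed
  qed
  then have "card (homs S A (union_rep G H)) = card ?P"
    by (rule bij_betw_same_card)
  also have "\<dots> = (\<Sum>x\<in>T \<rightarrow>\<^sub>E S. card (extensions S A x T G \<times> extensions S A x T H))"
    using G H S T finite_vertices[OF G] by (intro card_SigmaI)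
      (auto intro!: finite_PiE finite_extensions)
  finally show ?thesis
    by (simp add: card_cartesian_product)
qed

section \<open>Vertices, edges and homomorphisms of a glued graph\<close>

lemma rename_labeled: "v \<in> labeled G \<Longrightarrow> rename f v = v"
  by (cases v) (auto simp: labeled_def)

lemma inj_on_rename: "inj f \<Longrightarrow> inj_on (rename f) X"
  using inj_rename inj_on_subset by blast

text \<open>Even and odd names keep the unlabeled vertices of the two factors apart, so the copies
  can meet only in labels.\<close>

lemma rename_eq_rename_iff:
  "rename (\<lambda>k. 2 * k) u = rename (\<lambda>k. 2 * k + 1) v \<longleftrightarrow> u = v \<and> label u \<noteq> None"
proof (cases u; cases v)
  fix k l assume "u = Unl k" "v = Unl l"
  then show ?thesis by simp presburger
qed auto

lemma rename_image_Int:
  "rename (\<lambda>k. 2 * k) ` fst G \<inter> rename (\<lambda>k. 2 * k + 1) ` fst H = labeled G \<inter> labeled H"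
  (is "?l = ?r")
proof
  show "?l \<subseteq> ?r"
  proof
    fix w assume "w \<in> ?l"
    then obtain u v where *: "w = rename (\<lambda>k. 2 * k) u" "u \<in> fst G" "w = rename (\<lambda>k. 2 * k + 1) v" "v \<in> fst H"
      by blast
    then have "u = v" "label u \<noteq> None"
      using rename_eq_rename_iff by metis+
    then have "u \<in> labeled G" "u \<in> labeled H"
      using * by (simp_all add: labeled_def)
    then show "w \<in> ?r"
      unfolding *(1) by (simp add: rename_labeled)
  qed
  show "?r \<subseteq> ?l"
  proof
    fix w assume "w \<in> ?r"
    then have "w \<in> fst G" "w \<in> fst H" "rename f w = w" for f
      using rename_labeled by (auto simp: labeled_def)
    then show "w \<in> ?l"
      by (metis IntI imageI)
  qed
qed

text \<open>With equal label sets the count is an entry of a Gram matrix, the inner product of the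
  two vectors of extension counts. This is what makes Cauchy-Schwarz available.\<close>

lemma card_homs_glue_rep:
  assumes G: "wf_rep G" and H: "wf_rep H" and S: "finite S"
    and T: "labeled G = T" "labeled H = T"
  shows "card (homs S A (glue_rep G H)) =
    (\<Sum>x\<in>T \<rightarrow>\<^sub>E S. card (extensions S A x T G) * card (extensions S A x T H))"
proof -
  have 1: "card (extensions S A x T (map_rep (rename f) G)) = card (extensions S A x T G)"
    and 2: "card (extensions S A x T (map_rep (rename f) H)) = card (extensions S A x T H)"
    if "inj f" for x f
  proof -
    have "T \<subseteq> fst G" "T \<subseteq> fst H"
      using T unfolding labeled_def by blast+
    moreover have "rename f v = v" if "v \<in> T" for v
      using rename_labeled that T(1) by blast
    ultimately show "card (extensions S A x T (map_rep (rename f) G)) = card (extensions S A x T G)"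
      "card (extensions S A x T (map_rep (rename f) H)) = card (extensions S A x T H)"
      using card_extensions_map_rep G H inj_on_rename[OF that] by metis+
  qed
  show ?thesis
    unfolding glue_rep_def
    by (subst card_homs_union_rep[OF wf_rename[OF G inj_double(1)] wf_rename[OF H inj_double(2)] S, of T])
      (simp add: T rename_image_Int map_rep_def[THEN arg_cong[of _ _ fst]] del: One_nat_def,
        simp only: 1[OF inj_double(1)] 2[OF inj_double(2)])
qed

lemma card_fst_glue_rep:
  assumes "wf_rep G" "wf_rep H"
  shows "card (fst (glue_rep G H)) + card (labeled G \<inter> labeled H) = card (fst G) + card (fst H)"
  using card_Un_Int[of "rename (\<lambda>k. 2 * k) ` fst G" "rename (\<lambda>k. 2 * k + 1) ` fst H"]
    rename_image_Int[of G H] card_image[OF inj_on_rename[OF inj_double(1)], of "fst G"]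
    card_image[OF inj_on_rename[OF inj_double(2)], of "fst H"] finite_vertices assms
  by (simp add: glue_rep_def union_rep_def map_rep_def)

text \<open>An edge common to both copies has its ends in the overlap of the vertex sets, so they
  are labeled and renaming leaves the edge unchanged.\<close>

lemma rename_edges_Int:
  assumes G: "wf_rep G" and H: "wf_rep H"
  shows "(`) (rename (\<lambda>k. 2 * k)) ` snd G \<inter> (`) (rename (\<lambda>k. 2 * k + 1)) ` snd H
    = labeled_edges G \<inter> labeled_edges H" (is "?l = ?r")
proof
  have fixed_image: "rename f ` e = e" if "e \<subseteq> labeled K" for f e K
  proof -
    have "rename f v = v" if "v \<in> e" for v
      using \<open>e \<subseteq> labeled K\<close> that rename_labeled by blast
    then show ?thesis
      by simp
  qed
  show "?r \<subseteq> ?l"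
  proof
    fix e assume e: "e \<in> ?r"
    then have "rename f ` e = e" for f
      using fixed_image[of e G f] by (simp add: labeled_edges_def)
    moreover have "e \<in> snd G" "e \<in> snd H"
      using e by (auto simp: labeled_edges_def)
    ultimately show "e \<in> ?l"
      by (metis IntI imageI)
  qed
  show "?l \<subseteq> ?r"
  proof
    fix c assume "c \<in> ?l"
    then obtain d e where *: "c = rename (\<lambda>k. 2 * k) ` d" "d \<in> snd G"
        "c = rename (\<lambda>k. 2 * k + 1) ` e" "e \<in> snd H"
      by blast
    then have c: "c \<subseteq> labeled G \<inter> labeled H"
      using edge_subset[OF G] edge_subset[OF H] unfolding rename_image_Int[symmetric] by blast
    have "v \<in> labeled G" if "v \<in> d" for v
    proof -
      have "label (rename (\<lambda>k. 2 * k) v) \<noteq> None"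
        using that * c by (auto simp: labeled_def)
      then show ?thesis
        using that * edge_subset[OF G] by (auto simp: labeled_def)
    qed
    moreover have "v \<in> labeled H" if "v \<in> e" for v
    proof -
      have "label (rename (\<lambda>k. 2 * k + 1) v) \<noteq> None"
        using that *(3) c unfolding labeled_def by blast
      then show ?thesis
        using that * edge_subset[OF H] by (auto simp: labeled_def)
    qed
    ultimately have "d \<subseteq> labeled G" "e \<subseteq> labeled H"
      by blast+
    then have "c = d" "c = e"
      using fixed_image *(1,3) by metis+
    then show "c \<in> ?r"
      using * c unfolding labeled_edges_def by blast
  qed
qed

lemma card_snd_glue_rep:
  assumes "wf_rep G" "wf_rep H"
  shows "card (snd (glue_rep G H)) + card (labeled_edges G \<inter> labeled_edges H)
    = card (snd G) + card (snd H)"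
  using card_Un_Int[of "(`) (rename (\<lambda>k. 2 * k)) ` snd G" "(`) (rename (\<lambda>k. 2 * k + 1)) ` snd H"]
    rename_edges_Int[OF assms] card_snd_map_rep[OF assms(1) inj_on_rename[OF inj_double(1)]]
    card_snd_map_rep[OF assms(2) inj_on_rename[OF inj_double(2)]] finite_edges assms
  by (simp add: glue_rep_def union_rep_def map_rep_def)

text \<open>With its equality case below, this is the source of convexity: gluing saves the
  intersection of the labeled parts, which on average is largest for squares.\<close>

lemma card_Int_le:
  assumes "finite X" "finite Y"
  shows "2 * card (X \<inter> Y) \<le> card X + card Y"
  using card_mono[of X "X \<inter> Y"] card_mono[of Y "X \<inter> Y"] assms by auto

lemma card_Int_eq:
  assumes "finite X" "finite Y" "card X + card Y \<le> 2 * card (X \<inter> Y)"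
  shows "X = Y"
proof -
  have "card (X \<inter> Y) = card X" "card (X \<inter> Y) = card Y"
    using card_mono[of X "X \<inter> Y"] card_mono[of Y "X \<inter> Y"] assms by auto
  then show ?thesis
    using card_subset_eq[of X "X \<inter> Y"] card_subset_eq[of Y "X \<inter> Y"] assms by auto
qed

text \<open>Lovasz's argument: by inclusion-exclusion over \<open>S\<close>, the counts of extensions determine the
  number of homomorphisms onto \<open>fst K\<close>, and the identity is one of them for \<open>K\<close> itself.\<close>

lemma iso_rep_if_extensions_eq:
  assumes K: "wf_rep K" and K': "wf_rep K'"
    and T: "labeled K = T" "labeled K' = T"
    and card: "card (fst K) = card (fst K')" "card (snd K) = card (snd K')"
    and eq: "\<And>S. S \<subseteq> fst K \<Longrightarrow> card (extensions S (snd K) (restrict id T) T K)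
      = card (extensions S (snd K) (restrict id T) T K')"
  shows "iso_rep K' K"
proof -
  let ?ext = "\<lambda>S. extensions S (snd K) (restrict id T) T"
  \<comment> \<open>Sorting maps by their exact image makes the inclusion-exclusion over
    \<open>S\<close> triangular.\<close>
  define onto where "onto S G = {\<phi> \<in> ?ext S G. \<phi> ` fst G = S}" for S G
  have fin: "finite (fst K)" "finite (fst K')"
    using finite_vertices[OF K] finite_vertices[OF K'] by simp_all
  have split: "card (?ext S G) = card (onto S G) + (\<Sum>R\<in>Pow S - {S}. card (onto R G))"
    if "finite S" "wf_rep G" for S G
  proof -
    have "?ext S G = (\<Union>R\<in>Pow S. onto R G)"
    proof (intro equalityI subsetI)
      fix \<phi>
      assume "\<phi> \<in> ?ext S G"
      then have "\<phi> \<in> onto (\<phi> ` fst G) G" "\<phi> ` fst G \<subseteq> S"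
        unfolding onto_def extensions_def homs_def PiE_def Pi_def by blast+
      then show "\<phi> \<in> (\<Union>R\<in>Pow S. onto R G)"
        by blast
    next
      fix \<phi>
      assume "\<phi> \<in> (\<Union>R\<in>Pow S. onto R G)"
      then show "\<phi> \<in> ?ext S G"
        unfolding onto_def extensions_def homs_def PiE_def Pi_def by blast
    qed
    moreover have "finite (onto R G)" if "R \<subseteq> S" for R
      using finite_extensions[OF \<open>wf_rep G\<close> finite_subset[OF that \<open>finite S\<close>]]
      by (simp add: onto_def)
    ultimately have "card (?ext S G) = (\<Sum>R\<in>Pow S. card (onto R G))"
      using \<open>finite S\<close> by (simp only:) (rule card_UN_disjoint; auto simp: onto_def)
    also have "\<dots> = card (onto S G) + (\<Sum>R\<in>Pow S - {S}. card (onto R G))"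
      using \<open>finite S\<close> by (intro sum.remove) auto
    finally show ?thesis .
  qed
  \<comment> \<open>Strong induction on \<open>S\<close>: the totals agree by \<open>eq\<close> and
    the contributions of proper subsets agree by induction, so what is left agrees too.\<close>
  have onto_eq: "card (onto S K) = card (onto S K')" if "S \<subseteq> fst K" for S
    using finite_subset[OF that fin(1)] that
  proof (induction S rule: finite_psubset_induct)
    case (psubset S)
    have "(\<Sum>R\<in>Pow S - {S}. card (onto R K)) = (\<Sum>R\<in>Pow S - {S}. card (onto R K'))"
      using psubset by (intro sum.cong) auto
    then show ?case
      using split[OF psubset(1) K] split[OF psubset(1) K'] eq[OF psubset.prems] by simp
  qed
  \<comment> \<open>The identity shows that \<open>onto (fst K) K\<close> is nonempty, so by
    \<open>onto_eq\<close> some map takes \<open>K'\<close> onto \<open>fst K\<close>.\<close>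
  have "restrict id (fst K) ` e = e" if "e \<in> snd K" for e
    using edge_subset[OF K that] by force
  then have "restrict id (fst K) \<in> onto (fst K) K"
    using T by (auto simp: onto_def extensions_def homs_def labeled_def restrict_def fun_eq_iff)
  moreover have "finite (onto (fst K) K)"
    using finite_extensions[OF K fin(1)] by (simp add: onto_def)
  ultimately have "card (onto (fst K) K') \<noteq> 0"
    using onto_eq[of "fst K"] by (metis card_eq_0_iff empty_iff order_refl)
  then obtain \<psi> where \<psi>: "\<psi> \<in> onto (fst K) K'"
    by (metis card.empty equals0I)
  then have im: "\<psi> ` fst K' = fst K" and edges: "\<forall>e\<in>snd K'. \<psi> ` e \<in> snd K"
    and fixed_image: "restrict \<psi> T = restrict id T"
    by (auto simp: onto_def extensions_def homs_def)
  have inj: "inj_on \<psi> (fst K')"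
    using im card fin by (intro eq_card_imp_inj_on) auto
  have T_fix: "\<psi> v = v" if "v \<in> T" for v
    using fixed_image that by (metis id_apply restrict_apply')
  \<comment> \<open>A vertex of \<open>K'\<close> outside \<open>T\<close> is unlabeled, and
    injectivity keeps it from landing in \<open>T\<close>, whose points are already images of
    themselves.\<close>
  have lab: "label (\<psi> v) = label v" if v: "v \<in> fst K'" for v
  proof (cases "v \<in> T")
    case False
    then have "label v = None"
      using T v by (auto simp: labeled_def)
    moreover have "\<psi> v \<notin> T"
      using False T_fix inj v T by (metis (no_types, lifting) inj_on_eq_iff labeled_def mem_Collect_eq)
    ultimately show ?thesis
      using T im v by (auto simp: labeled_def)
  qed (simp add: T_fix)
  \<comment> \<open>Image edges lie in \<open>snd K\<close>; the equal number of edges turns this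
    inclusion into equality.\<close>
  have "card (snd (map_rep \<psi> K')) = card (snd K)"
    using card card_snd_map_rep[OF K' inj] by simp
  moreover have "snd (map_rep \<psi> K') \<subseteq> snd K"
    using edges by (auto simp: map_rep_def)
  ultimately have "snd (map_rep \<psi> K') = snd K"
    using finite_edges[OF K] by (intro card_subset_eq)
  then have "map_rep \<psi> K' = K"
    using im by (simp add: map_rep_def prod_eq_iff)
  then show ?thesis
    using iso_repI[OF K' inj] lab by auto
qed

subsection \<open>Convexity under gluing\<close>

lift_definition vertex_count :: "plgraph \<Rightarrow> nat" is "\<lambda>G. card (fst G)"
  by (auto simp: iso_rep_def card_fst_map_rep)

lift_definition edge_count :: "plgraph \<Rightarrow> nat" is "\<lambda>G. card (snd G)"
  by (auto simp: iso_rep_def card_snd_map_rep)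

lift_definition hom_count :: "vertex set \<Rightarrow> vertex set set \<Rightarrow> plgraph \<Rightarrow> nat" is
  "\<lambda>S A G. card (homs S A G)"
  by (auto simp: iso_rep_def card_homs_map_rep)

lemma inj_on_drop_label: "inj_on drop_label X"
  using inj_drop_label inj_on_subset by blast

lemma vertex_count_remove_labels [simp]: "vertex_count (remove_labels G) = vertex_count G"
  by transfer (simp add: card_fst_map_rep inj_on_drop_label)

lemma edge_count_remove_labels [simp]: "edge_count (remove_labels G) = edge_count G"
  by transfer (simp add: card_snd_map_rep inj_on_drop_label iso_rep_def)

lemma hom_count_remove_labels [simp]: "hom_count S A (remove_labels G) = hom_count S A G"
  by transfer (simp add: card_homs_map_rep inj_on_drop_label iso_rep_def)

lemma plgraph_rep:
  obtains R where "wf_rep R" "G = abs_plgraph R"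
  using Quotient3_abs_rep[OF Quotient3_plgraph, of G] Quotient3_rep_reflp[OF Quotient3_plgraph, of G]
  by (metis iso_rep_def)

lemma abs_plgraph_eqI: "iso_rep R R' \<Longrightarrow> abs_plgraph R = abs_plgraph R'"
  using Quotient3_rel_abs[OF Quotient3_plgraph] by blast

lemmas abs_eqs = vertex_count.abs_eq edge_count.abs_eq hom_count.abs_eq plus_plgraph.abs_eq

lemma labeled_edges_subset: "labeled_edges G \<subseteq> snd G"
  by (auto simp: labeled_edges_def)

lemma labeled_subset: "labeled G \<subseteq> fst G"
  by (auto simp: labeled_def)

lemma finite_labeled: "wf_rep G \<Longrightarrow> finite (labeled G)" "wf_rep G \<Longrightarrow> finite (labeled_edges G)"
  using finite_subset[OF labeled_subset] finite_subset[OF labeled_edges_subset]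
    finite_vertices finite_edges by blast+

lemma vertex_count_abs:
  assumes "wf_rep G" "wf_rep H"
  shows "vertex_count (abs_plgraph G + abs_plgraph H) + card (labeled G \<inter> labeled H) = card (fst G) + card (fst H)"
  using assms by (simp add: abs_eqs iso_rep_refl wf_glue_rep card_fst_glue_rep)

lemma edge_count_abs:
  assumes "wf_rep G" "wf_rep H"
  shows "edge_count (abs_plgraph G + abs_plgraph H) + card (labeled_edges G \<inter> labeled_edges H)
    = card (snd G) + card (snd H)"
  using assms by (simp add: abs_eqs iso_rep_refl wf_glue_rep card_snd_glue_rep)

text \<open>By \<open>vertex_count_abs\<close> the sizes of the two factors cancel, and what remains
  is \<open>card_Int_le\<close> for the label sets. The same works for edges.\<close>

lemma vertex_count_convex: "vertex_count (G + G) + vertex_count (H + H) \<le> 2 * vertex_count (G + H)"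
proof -
  obtain R R' where R: "wf_rep R" "G = abs_plgraph R" "wf_rep R'" "H = abs_plgraph R'"
    using plgraph_rep by metis
  show ?thesis
    using vertex_count_abs[OF R(1,1)] vertex_count_abs[OF R(1,3)] vertex_count_abs[OF R(3,3)]
      card_Int_le[OF finite_labeled(1)[OF R(1)] finite_labeled(1)[OF R(3)]] R(2,4) by simp
qed

lemma edge_count_convex: "edge_count (G + G) + edge_count (H + H) \<le> 2 * edge_count (G + H)"
proof -
  obtain R R' where R: "wf_rep R" "G = abs_plgraph R" "wf_rep R'" "H = abs_plgraph R'"
    using plgraph_rep by metis
  show ?thesis
    using edge_count_abs[OF R(1,1)] edge_count_abs[OF R(1,3)] edge_count_abs[OF R(3,3)]
      card_Int_le[OF finite_labeled(2)[OF R(1)] finite_labeled(2)[OF R(3)]] R(2,4) by simp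
qed

text \<open>The equality case of convexity: the saved intersection is as large as possible, so
  \<open>card_Int_eq\<close> applies.\<close>

lemma labeled_edges_eq_if_edge_count:
  assumes R: "wf_rep R" and R': "wf_rep R'" and G: "G = abs_plgraph R" and H: "H = abs_plgraph R'"
    and eq: "edge_count (G + G) = edge_count (G + H)" "edge_count (H + H) = edge_count (G + H)"
  shows "labeled_edges R = labeled_edges R'" "card (snd R) = card (snd R')"
proof -
  have 1: "edge_count (G + G) + card (labeled_edges R) = 2 * card (snd R)"
    "edge_count (H + H) + card (labeled_edges R') = 2 * card (snd R')"
    "edge_count (G + H) + card (labeled_edges R \<inter> labeled_edges R') = card (snd R) + card (snd R')"
    using edge_count_abs[OF R R] edge_count_abs[OF R R'] edge_count_abs[OF R' R'] G H by simp_all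
  then have "card (labeled_edges R) + card (labeled_edges R') \<le> 2 * card (labeled_edges R \<inter> labeled_edges R')"
    using eq by linarith
  then show "labeled_edges R = labeled_edges R'"
    using card_Int_eq[OF finite_labeled(2)[OF R] finite_labeled(2)[OF R']] by blast
  then show "card (snd R) = card (snd R')"
    using 1 eq by simp
qed

lemma labeled_eq_if_vertex_count:
  assumes R: "wf_rep R" and R': "wf_rep R'" and G: "G = abs_plgraph R" and H: "H = abs_plgraph R'"
    and eq: "vertex_count (G + G) = vertex_count (G + H)" "vertex_count (H + H) = vertex_count (G + H)"
  shows "labeled R = labeled R'" "card (fst R) = card (fst R')"
proof -
  have 1: "vertex_count (G + G) + card (labeled R) = 2 * card (fst R)"
    "vertex_count (H + H) + card (labeled R') = 2 * card (fst R')"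
    "vertex_count (G + H) + card (labeled R \<inter> labeled R') = card (fst R) + card (fst R')"
    using vertex_count_abs[OF R R] vertex_count_abs[OF R R'] vertex_count_abs[OF R' R'] G H by simp_all
  then have "card (labeled R) + card (labeled R') \<le> 2 * card (labeled R \<inter> labeled R')"
    using eq by linarith
  then show "labeled R = labeled R'"
    using card_Int_eq[OF finite_labeled(1)[OF R] finite_labeled(1)[OF R']] by blast
  then show "card (fst R) = card (fst R')"
    using 1 eq by simp
qed

text \<open>All edges of a fully labeled \<open>G\<close> are labeled edges, so in the equality case
  \<open>H\<close> has these edges and no room for others. Without isolated vertices the edges
  determine the graph. This takes care of the roots of a trivial square.\<close>

lemma fully_labeled_eq:
  assumes fl: "fully_labeled G" and ni: "no_isolated G" "no_isolated H"
    and eq: "edge_count (G + G) = edge_count (G + H)" "edge_count (H + H) = edge_count (G + H)"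
  shows "G = H"
proof -
  obtain R R' where R: "wf_rep R" "G = abs_plgraph R" "wf_rep R'" "H = abs_plgraph R'"
    using plgraph_rep by metis
  note * = labeled_edges_eq_if_edge_count[OF R(1,3,2,4) eq]
  have iso: "iso_rep R R" "iso_rep R' R'"
    using R iso_rep_refl by auto
  have "\<forall>v\<in>fst R. label v \<noteq> None"
    using fl unfolding R(2) by (simp add: fully_labeled.abs_eq[OF iso(1)])
  then have "labeled R = fst R"
    by (auto simp: labeled_def)
  then have "labeled_edges R = snd R"
    using edge_subset[OF R(1)] by (auto simp: labeled_edges_def)
  then have edges: "snd R' = snd R"
    using * card_subset_eq[OF finite_edges[OF R(3)] labeled_edges_subset[of R']] by simp
  have "fst Q = \<Union> (snd Q)" if "wf_rep Q" "no_isolated (abs_plgraph Q)" for Q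
    using that edge_subset[OF that(1)] no_isolated.abs_eq[OF iso_rep_refl[OF that(1)]] by blast
  then have "fst R = fst R'"
    using R ni edges by metis
  then show ?thesis
    using R edges by (metis prod_eq_iff)
qed

section \<open>Strict convexity of homomorphism counts\<close>

lemma hom_count_abs:
  assumes "wf_rep G" "wf_rep H" "finite S" "labeled G = T" "labeled H = T"
  shows "hom_count S A (abs_plgraph G + abs_plgraph H) =
    (\<Sum>x\<in>T \<rightarrow>\<^sub>E S. card (extensions S A x T G) * card (extensions S A x T H))"
  using assms by (simp add: abs_eqs iso_rep_refl wf_glue_rep card_homs_glue_rep)

lemma extensions_eq_empty:
  assumes "T \<subseteq> fst G" "x \<notin> T \<rightarrow>\<^sub>E S"
  shows "extensions S A x T G = {}"
proof -
  have "restrict \<phi> T \<in> T \<rightarrow>\<^sub>E S" if "\<phi> \<in> homs S A G" for \<phi>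
    using that assms(1) by (intro restrict_PiE_iff[THEN iffD2]) (auto simp: homs_def PiE_iff subset_iff)
  then show ?thesis
    using assms(2) unfolding extensions_def by blast
qed

text \<open>The distinguishing target depends on the pair of graphs; adding over all targets within
  \<open>U\<close> gives a single integer that can be maximised.\<close>

definition hom_sum :: "vertex set \<Rightarrow> plgraph \<Rightarrow> nat" where
  "hom_sum U G = (\<Sum>S\<in>Pow U. \<Sum>A\<in>Pow (Pow U). hom_count S A G)"

lemma hom_sum_remove_labels [simp]: "hom_sum U (remove_labels G) = hom_sum U G"
  by (simp add: hom_sum_def)

text \<open>For each target the defect is a sum of squares of differences of extension counts. If
  all of them vanished, \<open>iso_rep_if_extensions_eq\<close> would identify the graphs;
  \<open>fst R\<close> lies in \<open>U\<close> so that the targets it asks for are among those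
  summed.\<close>

lemma hom_sum_strict:
  assumes R: "wf_rep R" "wf_rep R'" "G = abs_plgraph R" "H = abs_plgraph R'" and "G \<noteq> H"
    and U: "finite U" "fst R \<subseteq> U"
    and edge_count: "edge_count (G + G) = edge_count (G + H)" "edge_count (H + H) = edge_count (G + H)"
    and vertex_count: "vertex_count (G + G) = vertex_count (G + H)" "vertex_count (H + H) = vertex_count (G + H)"
  shows "2 * hom_sum U (G + H) < hom_sum U (G + G) + hom_sum U (H + H)"
proof -
  define T where "T = labeled R"
  note cardE = labeled_edges_eq_if_edge_count(2)[OF R(1-4) edge_count]
  note cardV = labeled_eq_if_vertex_count(2)[OF R(1-4) vertex_count]
  have T: "labeled R = T" "labeled R' = T"
    using labeled_eq_if_vertex_count(1)[OF R(1-4) vertex_count] T_def by simp_all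
  let ?d = "\<lambda>S A x. int (card (extensions S A x T R)) - int (card (extensions S A x T R'))"
  have square: "int (hom_count S A (G + G)) + int (hom_count S A (H + H)) - 2 * int (hom_count S A (G + H))
      = (\<Sum>x\<in>T \<rightarrow>\<^sub>E S. (?d S A x)\<^sup>2)" if "finite S" for S A
    unfolding R(3,4) using R(1,2) T that
    by (simp add: hom_count_abs sum.distrib sum_subtractf sum_distrib_left power2_eq_square algebra_simps)
  have "\<not> (\<forall>S A. S \<subseteq> U \<longrightarrow> A \<subseteq> Pow U \<longrightarrow> (\<forall>x\<in>T \<rightarrow>\<^sub>E S. ?d S A x = 0))"
  proof
    assume *: "\<forall>S A. S \<subseteq> U \<longrightarrow> A \<subseteq> Pow U \<longrightarrow> (\<forall>x\<in>T \<rightarrow>\<^sub>E S. ?d S A x = 0)"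
    \<comment> \<open>If \<open>x\<close> does not map \<open>T\<close> into \<open>S\<close>, as
      for the identity when \<open>S\<close> misses a label, both sets are empty.\<close>
    have "card (extensions S (snd R) x T R) = card (extensions S (snd R) x T R')"
      if "S \<subseteq> fst R" for S x
    proof (cases "x \<in> T \<rightarrow>\<^sub>E S")
      case True
      have "S \<subseteq> U" "snd R \<subseteq> Pow U"
        using that U(2) edge_subset[OF R(1)] by blast+
      then show ?thesis
        using * True by force
    next
      case False
      then show ?thesis
        using extensions_eq_empty[of T R] extensions_eq_empty[of T R'] T labeled_subset by metis
    qed
    then have "iso_rep R' R"
      using iso_rep_if_extensions_eq[OF R(1,2) T cardV cardE] by blast
    then show False
      using R(3,4) \<open>G \<noteq> H\<close> abs_plgraph_eqI by metis
  qed
  then obtain S0 A0 x0 where 0: "S0 \<subseteq> U" "A0 \<subseteq> Pow U" "x0 \<in> T \<rightarrow>\<^sub>E S0" "?d S0 A0 x0 \<noteq> 0"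
    by blast
  have finU: "finite (Pow U)" "finite (Pow (Pow U))"
    using U by auto
  have fin: "finite (T \<rightarrow>\<^sub>E S0)"
    using 0 U finite_subset finite_labeled(1)[OF R(1)] T_def by (auto intro!: finite_PiE)
  \<comment> \<open>A single nonzero difference makes the total defect positive, since all other
    summands are nonnegative.\<close>
  have "0 < (\<Sum>x\<in>T \<rightarrow>\<^sub>E S0. (?d S0 A0 x)\<^sup>2)"
    using fin 0 by (intro sum_pos2) auto
  moreover have "(\<Sum>x\<in>T \<rightarrow>\<^sub>E S0. (?d S0 A0 x)\<^sup>2) \<le> (\<Sum>A\<in>Pow (Pow U). \<Sum>x\<in>T \<rightarrow>\<^sub>E S0. (?d S0 A x)\<^sup>2)"
    using finU(2) 0(2) by (intro member_le_sum) (auto intro!: sum_nonneg)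
  moreover have "\<dots> \<le> (\<Sum>S\<in>Pow U. \<Sum>A\<in>Pow (Pow U). \<Sum>x\<in>T \<rightarrow>\<^sub>E S. (?d S A x)\<^sup>2)"
    using finU(1) 0(1) by (intro member_le_sum[where f = "\<lambda>S. \<Sum>A\<in>Pow (Pow U). \<Sum>x\<in>T \<rightarrow>\<^sub>E S. (?d S A x)\<^sup>2"])
      (auto intro!: sum_nonneg)
  moreover have "\<dots> = (\<Sum>S\<in>Pow U. \<Sum>A\<in>Pow (Pow U).
      int (hom_count S A (G + G)) + int (hom_count S A (H + H)) - 2 * int (hom_count S A (G + H)))"
    using finite_subset[OF _ U(1)] by (intro sum.cong refl square[symmetric]) auto
  moreover have "\<dots> = int (hom_sum U (G + G)) + int (hom_sum U (H + H)) - 2 * int (hom_sum U (G + H))"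
    by (simp add: hom_sum_def sum.distrib sum_subtractf sum_distrib_left)
  ultimately show ?thesis
    by linarith
qed

subsection \<open>Low terms of sums of squares\<close>

lemma unlabel_superset:
  assumes "finite B" "Poly_Mapping.keys a \<subseteq> B"
  shows "unlabel a = (\<Sum>G\<in>B. Poly_Mapping.single (remove_labels G) (Poly_Mapping.lookup a G))"
  unfolding unlabel_def using assms by (intro sum.mono_neutral_left) (auto simp: in_keys_iff)

lemma unlabel_zero [simp]: "unlabel 0 = 0"
  by (simp add: unlabel_def)

lemma unlabel_single [simp]:
  "unlabel (Poly_Mapping.single G c) = Poly_Mapping.single (remove_labels G) c"
  by (simp add: unlabel_def)

lemma unlabel_add: "unlabel (a + b) = unlabel a + unlabel b"
proof -
  let ?B = "Poly_Mapping.keys a \<union> Poly_Mapping.keys b"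
  have "Poly_Mapping.keys (a + b) \<subseteq> ?B"
    by (rule Poly_Mapping.keys_add)
  then show ?thesis
    using unlabel_superset[of ?B a] unlabel_superset[of ?B b] unlabel_superset[of ?B "a + b"]
    by (simp add: lookup_add single_add sum.distrib)
qed

lemma unlabel_sum: "unlabel (sum f I) = (\<Sum>i\<in>I. unlabel (f i))"
  by (induction I rule: infinite_finite_induct) (simp_all add: unlabel_add)

lemma sum_single_lookup:
  "(\<Sum>k\<in>Poly_Mapping.keys p. Poly_Mapping.single k (Poly_Mapping.lookup p k)) = p"
proof (rule poly_mapping_eqI)
  fix k
  have "(\<Sum>l\<in>Poly_Mapping.keys p. (Poly_Mapping.lookup p l when l = k)) = Poly_Mapping.lookup p k"
    by (cases "k \<in> Poly_Mapping.keys p") (simp_all add: when_def in_keys_iff)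
  then show "Poly_Mapping.lookup
      (\<Sum>k\<in>Poly_Mapping.keys p. Poly_Mapping.single k (Poly_Mapping.lookup p k)) k = Poly_Mapping.lookup p k"
    by (simp add: lookup_sum lookup_single)
qed

lemma lookup_unlabel_square:
  "Poly_Mapping.lookup (unlabel (a\<^sup>2)) F =
    (\<Sum>K\<in>Poly_Mapping.keys a. \<Sum>K'\<in>Poly_Mapping.keys a.
      (Poly_Mapping.lookup a K * Poly_Mapping.lookup a K' when remove_labels (K + K') = F))"
proof -
  have "a\<^sup>2 = (\<Sum>K\<in>Poly_Mapping.keys a. Poly_Mapping.single K (Poly_Mapping.lookup a K)) *
      (\<Sum>K\<in>Poly_Mapping.keys a. Poly_Mapping.single K (Poly_Mapping.lookup a K))"
    by (simp add: power2_eq_square sum_single_lookup)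
  then show ?thesis
    by (simp add: sum_product mult_single unlabel_sum lookup_sum lookup_single)
qed

lemma lookup_sum_list: "Poly_Mapping.lookup (sum_list fs) F = (\<Sum>f\<leftarrow>fs. Poly_Mapping.lookup f F)"
  by (induction fs) (simp_all add: lookup_add)

text \<open>If \<open>F\<close> arises from no product of two different graphs of \<open>a\<close>,
  the cross terms vanish and the coefficient is a sum of real squares.\<close>

lemma lookup_unlabel_square_diagonal:
  assumes "\<And>K K'. \<lbrakk>K \<in> Poly_Mapping.keys a; K' \<in> Poly_Mapping.keys a; remove_labels (K + K') = F\<rbrakk> \<Longrightarrow> K = K'"
  shows "Poly_Mapping.lookup (unlabel (a\<^sup>2)) F =
    (\<Sum>K\<in>Poly_Mapping.keys a. ((Poly_Mapping.lookup a K)\<^sup>2 when remove_labels (K + K) = F))"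
  unfolding lookup_unlabel_square
proof (rule sum.cong[OF refl])
  fix K
  assume K: "K \<in> Poly_Mapping.keys a"
  have "(\<Sum>K'\<in>Poly_Mapping.keys a.
      (Poly_Mapping.lookup a K * Poly_Mapping.lookup a K' when remove_labels (K + K') = F)) =
    (\<Sum>K'\<in>{K}. (Poly_Mapping.lookup a K * Poly_Mapping.lookup a K' when remove_labels (K + K') = F))"
    using assms K by (intro sum.mono_neutral_right) (auto simp: when_def)
  then show "(\<Sum>K'\<in>Poly_Mapping.keys a.
      (Poly_Mapping.lookup a K * Poly_Mapping.lookup a K' when remove_labels (K + K') = F)) =
      ((Poly_Mapping.lookup a K)\<^sup>2 when remove_labels (K + K) = F)"
    by (simp add: power2_eq_square)
qed

lemma lookup_unlabel_square_nonneg: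
  assumes "\<And>K K'. \<lbrakk>K \<in> Poly_Mapping.keys a; K' \<in> Poly_Mapping.keys a; remove_labels (K + K') = F\<rbrakk> \<Longrightarrow> K = K'"
  shows "0 \<le> Poly_Mapping.lookup (unlabel (a\<^sup>2)) F"
  using lookup_unlabel_square_diagonal[OF assms] by (simp add: sum_nonneg when_def)

lemma lookup_unlabel_square_pos:
  assumes "\<And>K K'. \<lbrakk>K \<in> Poly_Mapping.keys a; K' \<in> Poly_Mapping.keys a; remove_labels (K + K') = F\<rbrakk> \<Longrightarrow> K = K'"
    and G: "G \<in> Poly_Mapping.keys a" "remove_labels (G + G) = F"
  shows "0 < Poly_Mapping.lookup (unlabel (a\<^sup>2)) F"
  by (subst lookup_unlabel_square_diagonal[OF assms(1)], assumption+, rule sum_pos2[of _ G]) (use G in \<open>auto simp: when_def in_keys_iff\<close>)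

section \<open>The extremal choice of a root\<close>

lemma trivial_squareD:
  "trivial_square H \<Longrightarrow> remove_labels (G + G) = H \<Longrightarrow> fully_labeled G \<and> remove_labels G = H"
  unfolding trivial_square_def by blast

text \<open>Two stages: first, no graph occurring in \<open>as\<close> has a low square other than
  \<open>H\<close>; then, no product of two of them is a low graph other than
  \<open>H\<close>.\<close>

lemma squares_coeff_zero:
  assumes as: "set as \<subseteq> combs" and f: "f = (\<Sum>a\<leftarrow>as. unlabel (a\<^sup>2))"
    and H: "trivial_square H" "edge_count H = m"
    and nonpos: "\<And>F. \<lbrakk>edge_count F \<le> m; F \<noteq> H\<rbrakk> \<Longrightarrow> Poly_Mapping.lookup f F \<le> 0"
    and F: "edge_count F \<le> m" "F \<noteq> H"
  shows "Poly_Mapping.lookup f F = 0"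
proof -
  define Ks where "Ks = (\<Union>a\<in>set as. Poly_Mapping.keys a)"
  have finKs: "finite Ks"
    by (simp add: Ks_def)
  have no_iso: "no_isolated K" if "K \<in> Ks" for K
    using as that by (auto simp: Ks_def combs_def)
  have lookup_f: "Poly_Mapping.lookup f F = (\<Sum>a\<leftarrow>as. Poly_Mapping.lookup (unlabel (a\<^sup>2)) F)" for F
    by (simp add: f lookup_sum_list comp_def)
  have edge_count_sq: "edge_count (K + K) = m" if "remove_labels (K + K) = H" for K
    using H(2) that edge_count_remove_labels[of "K + K"] by metis
  \<comment> \<open>A root of \<open>H\<close> is fully labeled, so \<open>fully_labeled_eq\<close>
    applies.\<close>
  have rigid: "K = K'" if "K \<in> Ks" "K' \<in> Ks" "remove_labels (K + K) = H"
    "edge_count (K + K) = edge_count (K + K')" "edge_count (K' + K') = edge_count (K + K')" for K K'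
    using fully_labeled_eq trivial_squareD[OF H(1)] no_iso that by blast
  define S where "S = {G \<in> Ks. edge_count (G + G) \<le> m \<and> remove_labels (G + G) \<noteq> H}"
  have "S = {}"
  proof (rule ccontr)
    assume "S \<noteq> {}"
    \<comment> \<open>Representatives are fixed once and for all, so that one finite
      \<open>U\<close> contains the vertices of all of them.\<close>
    have "\<exists>R. wf_rep R \<and> G = abs_plgraph R" for G
      using plgraph_rep by metis
    then obtain r where r: "\<And>G. wf_rep (r G)" "\<And>G. G = abs_plgraph (r G)"
      by metis
    define U where "U = (\<Union>G\<in>Ks. fst (r G))"
    have U: "finite U" "\<And>G. G \<in> Ks \<Longrightarrow> fst (r G) \<subseteq> U"
      using finKs r(1) finite_vertices by (auto simp: U_def)
    define h where "h G = hom_sum U (G + G)" for G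
    \<comment> \<open>A common bound for \<open>h\<close>, so that maximising \<open>h\<close>
      becomes minimising a natural number.\<close>
    define M where "M = (\<Sum>G\<in>Ks. h G)"
    have h_le: "h G \<le> M" if "G \<in> Ks" for G
      unfolding M_def using finKs that by (intro member_le_sum) auto
    obtain G where G: "G \<in> S" and
      min: "\<And>K. (K, G) \<in> measures [\<lambda>G. edge_count (G + G), \<lambda>G. vertex_count (G + G), \<lambda>G. M - h G] \<Longrightarrow> K \<notin> S"
      using wfE_min'[OF wf_measures \<open>S \<noteq> {}\<close>] by blast
    define F where "F = remove_labels (G + G)"
    have GK: "G \<in> Ks" "edge_count (G + G) \<le> m" "F \<noteq> H"
      using G by (auto simp: S_def F_def)
    have "K = K'" if K: "K \<in> Ks" "K' \<in> Ks" "remove_labels (K + K') = F" for K K'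
    proof (rule ccontr)
      assume "K \<noteq> K'"
      have same: "edge_count (K + K') = edge_count (G + G)" "vertex_count (K + K') = vertex_count (G + G)" "hom_sum U (K + K') = h G"
        using K(3) edge_count_remove_labels vertex_count_remove_labels hom_sum_remove_labels unfolding F_def h_def by metis+
      \<comment> \<open>Graphs of \<open>Ks\<close> outside \<open>S\<close> cannot do better: their
        squares have exactly \<open>m\<close> edges if the square is \<open>H\<close>, and more than
        \<open>m\<close> otherwise.\<close>
      have ge: "edge_count (G + G) \<le> edge_count (Q + Q)" if "Q \<in> Ks" for Q
        using min[of Q] that GK edge_count_sq[of Q] by (fastforce simp: S_def)
      have edge_count: "edge_count (K + K) = edge_count (K + K')" "edge_count (K' + K') = edge_count (K + K')"
        using ge[OF K(1)] ge[OF K(2)] edge_count_convex[of K K'] same(1) by linarith+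
      \<comment> \<open>If one of the squares were \<open>H\<close>, \<open>rigid\<close> would give
        \<open>K = K'\<close>.\<close>
      have "remove_labels (K + K) \<noteq> H" "remove_labels (K' + K') \<noteq> H"
        using rigid[of K K'] rigid[of K' K] K edge_count \<open>K \<noteq> K'\<close> by (auto simp: add.commute)
      then have S: "K \<in> S" "K' \<in> S"
        using K edge_count same GK by (auto simp: S_def)
      then have "vertex_count (G + G) \<le> vertex_count (K + K)" "vertex_count (G + G) \<le> vertex_count (K' + K')"
        using min[of K] min[of K'] edge_count same by force+
      then have vertex_count: "vertex_count (K + K) = vertex_count (K + K')" "vertex_count (K' + K') = vertex_count (K + K')"
        using vertex_count_convex[of K K'] same(2) by linarith+
      \<comment> \<open>The first two measures are tied, so minimality in the third makes
        \<open>h G\<close> the largest, which contradicts \<open>hom_sum_strict\<close>.\<close>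
      have "h K \<le> h G" "h K' \<le> h G"
        using min[of K] min[of K'] S edge_count vertex_count same h_le[OF K(1)] h_le[OF K(2)] h_le[OF GK(1)] by force+
      then show False
        using hom_sum_strict[OF r(1,1,2,2) \<open>K \<noteq> K'\<close> U(1) U(2)[OF K(1)] edge_count vertex_count] same(3)
        unfolding h_def by linarith
    qed
    then have diag: "\<And>K K'. \<lbrakk>K \<in> Poly_Mapping.keys a; K' \<in> Poly_Mapping.keys a; remove_labels (K + K') = F\<rbrakk> \<Longrightarrow> K = K'"
      if "a \<in> set as" for a
      using that by (auto simp: Ks_def)
    obtain a where a: "a \<in> set as" "G \<in> Poly_Mapping.keys a"
      using GK(1) by (auto simp: Ks_def)
    \<comment> \<open>By \<open>diag\<close> every square contributes a nonnegative amount to the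
      coefficient of \<open>F\<close>, and that of \<open>a\<close> a positive one.\<close>
    have "0 < Poly_Mapping.lookup (unlabel (a\<^sup>2)) F"
      using lookup_unlabel_square_pos[OF diag[OF a(1)] a(2)] F_def by blast
    also have "\<dots> \<le> Poly_Mapping.lookup f F"
      unfolding lookup_f using a(1) lookup_unlabel_square_nonneg[OF diag]
      by (intro member_le_sum_list) auto
    finally show False
      using nonpos[of F] GK by (simp add: F_def)
  qed
  have "remove_labels (K + K') \<noteq> F" if K: "K \<in> Ks" "K' \<in> Ks" for K K'
  proof
    assume KF: "remove_labels (K + K') = F"
    have le: "edge_count (K + K) + edge_count (K' + K') \<le> 2 * edge_count (K + K')" "edge_count (K + K') \<le> m"
      using edge_count_convex[of K K'] F(1) KF edge_count_remove_labels[of "K + K'"] by auto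
    have square: "remove_labels (Q + Q) = H" if "Q \<in> Ks" "edge_count (Q + Q) \<le> m" for Q
      using \<open>S = {}\<close> that by (auto simp: S_def)
    \<comment> \<open>By convexity one of the squares has at most \<open>m\<close> edges; it is then
      \<open>H\<close> with exactly \<open>m\<close>, which also caps the other at
      \<open>m\<close>.\<close>
    have "edge_count (K + K) = m \<or> edge_count (K' + K') = m"
      using le square[OF K(1)] square[OF K(2)] edge_count_sq by fastforce
    then have "remove_labels (K + K) = H" "remove_labels (K' + K') = H"
      using le square[OF K(1)] square[OF K(2)] by fastforce+
    then have "K = K'"
      using edge_count_sq[of K] edge_count_sq[of K'] le by (intro rigid[OF K]) simp_all
    then show False
      using KF F(2) \<open>remove_labels (K + K) = H\<close> by simp
  qed
  then have "Poly_Mapping.lookup (unlabel (a\<^sup>2)) F = 0" if "a \<in> set as" for a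
    using that unfolding lookup_unlabel_square by (intro sum.neutral ballI) (auto simp: Ks_def when_def)
  then show ?thesis
    unfolding lookup_f by (induction as) auto
qed

subsection \<open>The graph is a trivial square\<close>

text \<open>With the deleted cycle running through consecutive residues, the graph is the circulant
  modulo 10 with differences 3, 5 and 7. The table lists each edge in both directions, so that
  finite checks are decided by simplification.\<close>

definition adj :: "nat \<Rightarrow> nat \<Rightarrow> bool" where
  "adj i j \<longleftrightarrow> (i, j) \<in> {
      (0, 3), (0, 5), (0, 7), (1, 4), (1, 6), (1, 8), (2, 5), (2, 7), (2, 9), (3, 6), (3, 8),
      (3, 0), (4, 7), (4, 9), (4, 1), (5, 8), (5, 0), (5, 2), (6, 9), (6, 1), (6, 3), (7, 0),
      (7, 2), (7, 4), (8, 1), (8, 3), (8, 5), (9, 2), (9, 4), (9, 6)}"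

lemma less_10: "(i::nat) < 10 \<longleftrightarrow> i \<in> {0, 1, 2, 3, 4, 5, 6, 7, 8, 9}"
  by auto

lemma adj_less: "adj i j \<Longrightarrow> i < 10 \<and> j < 10"
  unfolding adj_def by (elim insertE) simp_all

lemma adj_parity: "adj i j \<Longrightarrow> even i \<longleftrightarrow> odd j"
  unfolding adj_def by (elim insertE) simp_all

lemma adj_sym: "adj i j \<Longrightarrow> adj j i"
  unfolding adj_def by (elim insertE) simp_all

lemma adj_cases: "adj i j \<Longrightarrow> j = (i + 3) mod 10 \<or> j = (i + 5) mod 10 \<or> j = (i + 7) mod 10"
  unfolding adj_def by (elim insertE) simp_all

lemma adj_Suc: "adj i j \<Longrightarrow> adj (Suc i mod 10) (Suc j mod 10)"
  unfolding adj_def by (elim insertE) simp_all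

text \<open>This symmetry reduces claims about an arbitrary vertex to vertex 0.\<close>

lemma adj_rotate: "adj i j \<Longrightarrow> adj ((i + v) mod 10) ((j + v) mod 10)"
proof (induction v)
  case 0
  then show ?case
    using adj_less[of i j] by simp
next
  case (Suc v)
  then show ?case
    using adj_Suc[of "(i + v) mod 10" "(j + v) mod 10"] by (simp add: mod_Suc_eq)
qed

lemma edge_iff_adj: "{Unl i, Unl j} \<in> K55_edges - C10_edges \<longleftrightarrow> adj i j"
proof -
  have 1: "{Unl i, Unl j} \<in> K55_edges \<longleftrightarrow> i < 10 \<and> j < 10 \<and> (even i \<longleftrightarrow> odd j)"
    by (auto simp: K55_edges_def doubleton_eq_iff)
  have 2: "{Unl i, Unl j} \<in> C10_edges \<longleftrightarrow>
      i < 10 \<and> j = (i + 1) mod 10 \<or> j < 10 \<and> i = (j + 1) mod 10"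
    by (auto simp: C10_edges_def doubleton_eq_iff)
  have "(even i \<longleftrightarrow> odd j) \<and> j \<noteq> (i + 1) mod 10 \<and> i \<noteq> (j + 1) mod 10 \<longleftrightarrow> adj i j"
    if "i < 10" "j < 10"
    using that unfolding less_10 adj_def by (elim insertE emptyE) simp_all
  then show ?thesis
    using 1 2 adj_less[of i j] by blast
qed

lemma K55_minus_C10_edges: "K55_edges - C10_edges = {{Unl i, Unl j} | i j. adj i j}"
proof (intro equalityI subsetI)
  fix e
  assume e: "e \<in> K55_edges - C10_edges"
  then obtain i j where "e = {Unl i, Unl j}"
    by (auto simp: K55_edges_def)
  then show "e \<in> {{Unl i, Unl j} | i j. adj i j}"
    using e edge_iff_adj by blast
next
  fix e
  assume "e \<in> {{Unl i, Unl j} | i j. adj i j}"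
  then show "e \<in> K55_edges - C10_edges"
    using edge_iff_adj by blast
qed

lemma card_K55_minus_C10_edges: "card (K55_edges - C10_edges) = 15"
proof -
  \<comment> \<open>One ordered pair for each edge, its even end first.\<close>
  define E :: "(nat \<times> nat) set" where "E = {(0, 3), (0, 5), (0, 7), (2, 5), (2, 7), (2, 9), (4, 7), (4, 9), (4, 1), (6, 9), (6, 1),
      (6, 3), (8, 1), (8, 3), (8, 5)}"
  have E: "(i, j) \<in> E \<longleftrightarrow> adj i j \<and> even i" for i j
    unfolding adj_def E_def by (rule iffI; (elim conjE)?; elim insertE emptyE; simp)
  have "K55_edges - C10_edges = (\<lambda>(i, j). {Unl i, Unl j}) ` E"
  proof (intro equalityI subsetI)
    fix e
    assume "e \<in> K55_edges - C10_edges"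
    then obtain i j where e: "e = {Unl i, Unl j}" "adj i j"
      unfolding K55_minus_C10_edges by blast
    then have "(i, j) \<in> E \<or> (j, i) \<in> E"
      using E adj_sym adj_parity by blast
    then show "e \<in> (\<lambda>(i, j). {Unl i, Unl j}) ` E"
      using e(1) by (metis (mono_tags, lifting) image_eqI insert_commute prod.case)
  next
    fix e
    assume "e \<in> (\<lambda>(i, j). {Unl i, Unl j}) ` E"
    then obtain i j where "(i, j) \<in> E" "e = {Unl i, Unl j}"
      by auto
    then show "e \<in> K55_edges - C10_edges"
      using E edge_iff_adj by metis
  qed
  moreover have "inj_on (\<lambda>(i, j). {Unl i, Unl j}) E"
  proof (rule inj_onI)
    fix p q
    assume *: "p \<in> E" "q \<in> E" "(case p of (i, j) \<Rightarrow> {Unl i, Unl j}) = (case q of (i, j) \<Rightarrow> {Unl i, Unl j})"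
    obtain i j k l where pq: "p = (i, j)" "q = (k, l)"
      by fastforce
    then have "adj i j" "adj k l" "even i" "even k"
      using * E by blast+
    then show "p = q"
      using *(3) adj_parity pq by (auto simp: doubleton_eq_iff)
  qed
  moreover have "card E = 15"
    by (simp add: E_def)
  ultimately show ?thesis
    by (simp add: card_image)
qed

text \<open>Here \<open>\<sigma>\<close> is the swap of the two copies of the unlabeled vertices in a square, \<open>X\<close> is one of these
  copies, and by \<open>sep\<close> no edge joins \<open>X\<close> to \<open>\<sigma> ` X\<close>.\<close>

lemma no_swap_at_0:
  assumes lt: "\<And>i. i < 10 \<Longrightarrow> \<sigma> i < 10" and inv: "\<And>i. i < 10 \<Longrightarrow> \<sigma> (\<sigma> i) = i"
    and hom: "\<And>i j. adj i j \<Longrightarrow> adj (\<sigma> i) (\<sigma> j)"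
    and moved: "\<And>i. i < 10 \<Longrightarrow> \<sigma> i \<noteq> i \<longleftrightarrow> X i \<or> X (\<sigma> i)"
    and sep: "\<And>i j. adj i j \<Longrightarrow> X i \<Longrightarrow> \<not> X (\<sigma> j)"
    and X0: "X 0"
  shows False
proof -
  \<comment> \<open>A common neighbour \<open>j\<close> of \<open>i\<close> and
    \<open>\<sigma> i\<close> makes both \<open>j\<close> and \<open>\<sigma> j\<close> neighbours
    of \<open>i\<close>; by \<open>sep\<close> neither is in \<open>X\<close>, so \<open>j\<close>
    is not moved.\<close>
  have fixed: "\<sigma> j = j" if "X i" "adj i j" "adj (\<sigma> i) j" for i j
  proof -
    have "i < 10" "j < 10"
      using adj_less[OF that(2)] by auto
    then have "adj i (\<sigma> j)"
      using hom[OF that(3)] inv by simp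
    then have "\<not> X j" "\<not> X (\<sigma> j)"
      using sep that inv \<open>j < 10\<close> by metis+
    then show ?thesis
      using moved \<open>j < 10\<close> by blast
  qed
  \<comment> \<open>If \<open>j\<close> were fixed, applying \<open>\<sigma>\<close> to its edge
    with \<open>i\<close> would join it to \<open>\<sigma> i\<close>. So \<open>j\<close> is moved,
    and \<open>sep\<close> leaves only \<open>X j\<close>.\<close>
  have free: "X j \<and> \<sigma> j \<noteq> j" if "X i" "adj i j" "\<not> adj (\<sigma> i) j" for i j
  proof -
    have "\<sigma> j \<noteq> j"
      using hom[OF that(2)] that(3) by metis
    then show ?thesis
      using moved[of j] sep[OF that(2,1)] adj_less[OF that(2)] by blast
  qed
  have nb: "\<sigma> j = (\<sigma> i + 3) mod 10 \<or> \<sigma> j = (\<sigma> i + 5) mod 10 \<or> \<sigma> j = (\<sigma> i + 7) mod 10"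
    if "adj i j" for i j
    using adj_cases[OF hom[OF that]] .
  \<comment> \<open>If \<open>\<sigma> 0\<close> were odd, membership in \<open>X\<close> and
    reversal of parity would spread together from neighbour to neighbour to all ten vertices, and
    \<open>X (\<sigma> 3)\<close> would contradict \<open>sep\<close>.\<close>
  have "even (\<sigma> 0)"
  proof (rule ccontr)
    assume odd: "odd (\<sigma> 0)"
    \<comment> \<open>A neighbour of \<open>i\<close> has the parity of \<open>\<sigma> i\<close>,
      so it is not adjacent to \<open>\<sigma> i\<close> and \<open>free\<close> applies.\<close>
    have step: "X j \<and> (even (\<sigma> j) \<longleftrightarrow> odd j)" if "X i \<and> (even (\<sigma> i) \<longleftrightarrow> odd i)" "adj i j" for i j
      using that free[of i j] adj_parity[of i j] adj_parity[of "\<sigma> i" j] adj_parity[OF hom[of i j]] by blast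
    have all: "X i \<and> (even (\<sigma> i) \<longleftrightarrow> odd i)" if "i < 10" for i
    proof -
      let ?P = "\<lambda>i. X i \<and> (even (\<sigma> i) \<longleftrightarrow> odd i)"
      have "?P 0"
        using X0 odd by simp
      moreover have "?P 3" if "?P 0" using step[OF that] by (simp add: adj_def)
      moreover have "?P 6" if "?P 3" using step[OF that] by (simp add: adj_def)
      moreover have "?P 9" if "?P 6" using step[OF that] by (simp add: adj_def)
      moreover have "?P 2" if "?P 9" using step[OF that] by (simp add: adj_def)
      moreover have "?P 5" if "?P 2" using step[OF that] by (simp add: adj_def)
      moreover have "?P 8" if "?P 5" using step[OF that] by (simp add: adj_def)
      moreover have "?P 1" if "?P 8" using step[OF that] by (simp add: adj_def)
      moreover have "?P 4" if "?P 1" using step[OF that] by (simp add: adj_def)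
      moreover have "?P 7" if "?P 4" using step[OF that] by (simp add: adj_def)
      ultimately show ?thesis
        using that unfolding less_10 by (elim insertE emptyE) simp_all
    qed
    have "adj 0 3"
      by (simp add: adj_def)
    then show False
      using sep[of 0 3] X0 all[of "\<sigma> 3"] lt[of 3] by simp
  qed
  moreover have "\<sigma> 0 \<noteq> 0"
    using moved[of 0] X0 by simp
  ultimately have "\<sigma> 0 \<in> {2, 4, 6, 8}"
    using lt[of 0] by (auto simp: less_10)
  then consider "\<sigma> 0 = 2" | "\<sigma> 0 = 4" | "\<sigma> 0 = 6" | "\<sigma> 0 = 8"
    by blast
  \<comment> \<open>In each case the common neighbours of 0 and \<open>\<sigma> 0\<close> are fixed,
    further values are forced one after another, and finally an edge is sent to a non-edge.\<close>
  then show False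
  proof cases
    case 1
    have "\<sigma> 2 = 0" using inv[of 0] 1 by simp
    have "\<sigma> 5 = 5" "\<sigma> 7 = 7" using fixed[OF X0] 1 by (simp_all add: adj_def)
    have "X 3" using free[OF X0, of 3] 1 by (simp add: adj_def)
    have "\<sigma> 3 = 9" using nb[of 0 3] 1 inv[of 3] \<open>\<sigma> 5 = 5\<close> \<open>\<sigma> 7 = 7\<close> by (auto simp: adj_def)
    have "\<sigma> 6 = 6" using fixed[OF \<open>X 3\<close>, of 6] \<open>\<sigma> 3 = 9\<close> by (simp add: adj_def)
    have "\<sigma> 8 = 4" using nb[of 3 8] \<open>\<sigma> 3 = 9\<close> inv[of 8] \<open>\<sigma> 2 = 0\<close> \<open>\<sigma> 6 = 6\<close> by (auto simp: adj_def)
    then show False using hom[of 8 5] \<open>\<sigma> 5 = 5\<close> by (simp add: adj_def)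
  next
    case 2
    have "\<sigma> 4 = 0" using inv[of 0] 2 by simp
    have "\<sigma> 7 = 7" using fixed[OF X0, of 7] 2 by (simp add: adj_def)
    have "\<sigma> 2 = 2" using nb[of 7 2] \<open>\<sigma> 7 = 7\<close> inv[of 2] 2 \<open>\<sigma> 4 = 0\<close> by (auto simp: adj_def)
    have "\<sigma> 5 = 9" using nb[of 0 5] 2 nb[of 2 5] \<open>\<sigma> 2 = 2\<close> inv[of 5] \<open>\<sigma> 7 = 7\<close> by (auto simp: adj_def)
    have "X 3" using free[OF X0, of 3] 2 by (simp add: adj_def)
    have "\<sigma> 9 = 5" using inv[of 5] \<open>\<sigma> 5 = 9\<close> by simp
    have "\<sigma> 3 = 1" using nb[of 0 3] 2 inv[of 3] \<open>\<sigma> 7 = 7\<close> \<open>\<sigma> 9 = 5\<close> by (auto simp: adj_def)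
    have "\<sigma> 8 = 8" using fixed[OF \<open>X 3\<close>, of 8] \<open>\<sigma> 3 = 1\<close> by (simp add: adj_def)
    then show False using hom[of 8 5] \<open>\<sigma> 5 = 9\<close> by (simp add: adj_def)
  next
    case 3
    have "\<sigma> 6 = 0" using inv[of 0] 3 by simp
    have "\<sigma> 3 = 3" using fixed[OF X0, of 3] 3 by (simp add: adj_def)
    have "\<sigma> 8 = 8" using nb[of 3 8] \<open>\<sigma> 3 = 3\<close> inv[of 8] 3 \<open>\<sigma> 6 = 0\<close> by (auto simp: adj_def)
    have "\<sigma> 5 = 1" using nb[of 0 5] 3 nb[of 8 5] \<open>\<sigma> 8 = 8\<close> inv[of 5] \<open>\<sigma> 3 = 3\<close> by (auto simp: adj_def)
    have "X 7" using free[OF X0, of 7] 3 by (simp add: adj_def)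
    have "\<sigma> 1 = 5" using inv[of 5] \<open>\<sigma> 5 = 1\<close> by simp
    have "\<sigma> 7 = 9" using nb[of 0 7] 3 inv[of 7] \<open>\<sigma> 3 = 3\<close> \<open>\<sigma> 1 = 5\<close> by (auto simp: adj_def)
    have "\<sigma> 2 = 2" using fixed[OF \<open>X 7\<close>, of 2] \<open>\<sigma> 7 = 9\<close> by (simp add: adj_def)
    then show False using hom[of 2 5] \<open>\<sigma> 5 = 1\<close> by (simp add: adj_def)
  next
    case 4
    have "\<sigma> 8 = 0" using inv[of 0] 4 by simp
    have "\<sigma> 5 = 5" "\<sigma> 3 = 3" using fixed[OF X0] 4 by (simp_all add: adj_def)
    have "X 7" using free[OF X0, of 7] 4 by (simp add: adj_def)
    have "\<sigma> 7 = 1" using nb[of 0 7] 4 inv[of 7] \<open>\<sigma> 5 = 5\<close> \<open>\<sigma> 3 = 3\<close> by (auto simp: adj_def)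
    have "\<sigma> 4 = 4" using fixed[OF \<open>X 7\<close>, of 4] \<open>\<sigma> 7 = 1\<close> by (simp add: adj_def)
    have "\<sigma> 2 = 6" using nb[of 7 2] \<open>\<sigma> 7 = 1\<close> inv[of 2] \<open>\<sigma> 8 = 0\<close> \<open>\<sigma> 4 = 4\<close> by (auto simp: adj_def)
    then show False using hom[of 2 5] \<open>\<sigma> 5 = 5\<close> by (simp add: adj_def)
  qed
qed

text \<open>Conjugating \<open>\<sigma>\<close> by the rotation that takes 0 to \<open>v\<close>
  reduces this to \<open>no_swap_at_0\<close>.\<close>

lemma no_swap:
  assumes lt: "\<And>i. i < 10 \<Longrightarrow> \<sigma> i < 10" and inv: "\<And>i. i < 10 \<Longrightarrow> \<sigma> (\<sigma> i) = i"
    and hom: "\<And>i j. adj i j \<Longrightarrow> adj (\<sigma> i) (\<sigma> j)"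
    and moved: "\<And>i. i < 10 \<Longrightarrow> \<sigma> i \<noteq> i \<longleftrightarrow> X i \<or> X (\<sigma> i)"
    and sep: "\<And>i j. adj i j \<Longrightarrow> X i \<Longrightarrow> \<not> X (\<sigma> j)"
    and v: "v < 10"
  shows "\<not> X v"
proof
  assume "X v"
  let ?r = "\<lambda>i. (i + v) mod 10"
  \<comment> \<open>Adding \<open>10 - v\<close> is the inverse rotation, expressed without a
    negative number.\<close>
  let ?\<tau> = "\<lambda>i. (\<sigma> (?r i) + (10 - v)) mod 10"
  have r\<tau>: "?r (?\<tau> i) = \<sigma> (?r i)" for i
    using lt[of "?r i"] v by (simp add: mod_simps)
  have rot_back: "(?r i + (10 - v)) mod 10 = i" if "i < 10" for i
  proof -
    have "((i + v) + (10 - v)) mod 10 = i"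
      using v that by simp
    then show ?thesis
      by (simp only: mod_add_left_eq)
  qed
  show False
  proof (rule no_swap_at_0[of ?\<tau> "\<lambda>i. X (?r i)"])
    fix i j :: nat
    show "?\<tau> i < 10"
      by simp
    show "?\<tau> (?\<tau> i) = i" if "i < 10"
      unfolding r\<tau> using inv[of "?r i"] rot_back[OF that] by simp
    show "?\<tau> i \<noteq> i \<longleftrightarrow> X (?r i) \<or> X (?r (?\<tau> i))" if "i < 10"
      unfolding r\<tau> using moved[of "?r i"] r\<tau>[of i] rot_back[OF that] by fastforce
    assume "adj i j"
    then have a: "adj (?r i) (?r j)"
      using adj_rotate by blast
    show "\<not> X (?r (?\<tau> j))" if "X (?r i)"
      unfolding r\<tau> using sep[OF a that] .
    show "adj (?\<tau> i) (?\<tau> j)"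
      using adj_rotate[OF hom[OF a]] .
  next
    show "X (?r 0)"
      using \<open>X v\<close> v by simp
  qed
qed

section \<open>From a square root of the graph to a swap of its vertices\<close>

lemma abs_plgraph_eqD: "abs_plgraph R = abs_plgraph R' \<Longrightarrow> wf_rep R \<Longrightarrow> wf_rep R' \<Longrightarrow> iso_rep R R'"
  using Quotient3_rel[OF Quotient3_plgraph, of R R'] iso_rep_refl by blast

lemma wf_K55_minus_C10: "wf_rep (Unl ` {..<10}, K55_edges - C10_edges)"
  using K55_minus_C10.rsp by (simp add: iso_rep_def)

text \<open>Exchanging the two copies of \<open>R\<close> in the square is an involution preserving
  edges; an unlabeled vertex would make it one of those excluded by \<open>no_swap\<close>.\<close>

lemma all_labeled_if_square:
  assumes R: "wf_rep R"
    and iso: "iso_rep (map_rep drop_label (glue_rep R R)) (Unl ` {..<10}, K55_edges - C10_edges)"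
    and v: "v \<in> fst R"
  shows "label v \<noteq> None"
proof
  assume None: "label v = None"
  let ?j1 = "\<lambda>v. drop_label (rename (\<lambda>k. 2 * k) v)" and ?j2 = "\<lambda>v. drop_label (rename (\<lambda>k. 2 * k + 1) v)"
  let ?V = "fst R"
  obtain h where inj_h: "inj_on h (fst (map_rep drop_label (glue_rep R R)))"
    and h: "(Unl ` {..<10}, K55_edges - C10_edges) = map_rep h (map_rep drop_label (glue_rep R R))"
    using iso unfolding iso_rep_def by blast
  \<comment> \<open>The embeddings of the two copies into the ten vertices; \<open>q1\<close> and
    \<open>q2\<close> below read off the numbers.\<close>
  define p1 p2 where "p1 v = h (?j1 v)" and "p2 v = h (?j2 v)" for v
  have union: "(Unl ` {..<10}, K55_edges - C10_edges) = union_rep (map_rep p1 R) (map_rep p2 R)"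
    unfolding h p1_def p2_def glue_rep_def map_rep_union map_rep_comp by simp
  have vertices: "Unl ` {..<10} = p1 ` ?V \<union> p2 ` ?V"
    and edges: "K55_edges - C10_edges = (`) p1 ` snd R \<union> (`) p2 ` snd R"
    using union by (simp_all add: union_rep_def map_rep_def)
  have inj_h': "inj_on h (?j1 ` ?V \<union> ?j2 ` ?V)"
    using inj_h by (simp add: map_rep_def glue_rep_def union_rep_def image_Un image_image)
  have p_eq: "p1 u = p1 w \<longleftrightarrow> u = w" "p2 u = p2 w \<longleftrightarrow> u = w" "p1 u = p2 w \<longleftrightarrow> u = w \<and> label u \<noteq> None"
    if "u \<in> ?V" "w \<in> ?V" for u w
    using that inj_on_eq_iff[OF inj_h'] inj_eq[OF inj_drop_label] inj_eq[OF inj_rename[OF inj_double(1)]]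
      inj_eq[OF inj_rename[OF inj_double(2)]] rename_eq_rename_iff[of u w]
    unfolding p1_def p2_def by simp_all
  have "\<forall>v\<in>?V. \<exists>k<10. p1 v = Unl k" "\<forall>v\<in>?V. \<exists>k<10. p2 v = Unl k"
    using vertices by blast+
  then obtain q1 q2 where q: "\<And>v. v \<in> ?V \<Longrightarrow> q1 v < 10 \<and> p1 v = Unl (q1 v)"
    "\<And>v. v \<in> ?V \<Longrightarrow> q2 v < 10 \<and> p2 v = Unl (q2 v)"
    by metis
  have q_eq: "q1 u = q1 w \<longleftrightarrow> u = w" "q2 u = q2 w \<longleftrightarrow> u = w" "q1 u = q2 w \<longleftrightarrow> u = w \<and> label u \<noteq> None"
    if "u \<in> ?V" "w \<in> ?V" for u w
    using p_eq[OF that] q that by (metis vertex.inject(2))+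
  \<comment> \<open>Where the copies overlap, the vertex is labeled and \<open>q1\<close> and
    \<open>q2\<close> agree on it, so both branches give the same value.\<close>
  define \<sigma> where "\<sigma> i = (if i \<in> q1 ` ?V then q2 (inv_into ?V q1 i) else q1 (inv_into ?V q2 i))" for i
  have inj_q: "inj_on q1 ?V" "inj_on q2 ?V"
    using q_eq by (auto simp: inj_on_def)
  have \<sigma>1: "\<sigma> (q1 u) = q2 u" if "u \<in> ?V" for u
    using that inj_q by (simp add: \<sigma>_def)
  have \<sigma>2: "\<sigma> (q2 u) = q1 u" if u: "u \<in> ?V" for u
  proof (cases "q2 u \<in> q1 ` ?V")
    case True
    then obtain w where w: "w \<in> ?V" "q2 u = q1 w"
      by auto
    then have "q1 u = q2 u"
      using q_eq(3)[OF w(1) u] by auto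
    then show ?thesis
      using \<sigma>1[OF u] by simp
  qed (use that inj_q in \<open>simp add: \<sigma>_def\<close>)
  define X where "X i \<longleftrightarrow> (\<exists>u\<in>?V. label u = None \<and> i = q1 u)" for i
  have X1: "X (q1 u) \<longleftrightarrow> label u = None" if "u \<in> ?V" for u
    using that q_eq(1) unfolding X_def by metis
  have X2: "\<not> X (q2 u)" if "u \<in> ?V" for u
    using that q_eq(3) unfolding X_def by metis
  have cover: "\<exists>u\<in>?V. i = q1 u \<or> i = q2 u" if "i < 10" for i
  proof -
    have "Unl i \<in> p1 ` ?V \<union> p2 ` ?V"
      using that vertices by blast
    then show ?thesis
      using q by fastforce
  qed
  \<comment> \<open>Every edge lies within one copy. Hence \<open>\<sigma>\<close> preserves edges,
    and no edge joins \<open>X\<close> to its mirror image.\<close>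
  have edge: "\<exists>u\<in>?V. \<exists>w\<in>?V. {u, w} \<in> snd R \<and> (i = q1 u \<and> j = q1 w \<or> i = q2 u \<and> j = q2 w)"
    if "adj i j" for i j
  proof -
    have e: "{Unl i, Unl j} \<in> (`) p1 ` snd R \<union> (`) p2 ` snd R"
      using that edge_iff_adj edges by blast
    have ex: "\<exists>u\<in>?V. \<exists>w\<in>?V. {u, w} \<in> snd R \<and> i = r u \<and> j = r w"
      if "{Unl i, Unl j} = p ` e" "e \<in> snd R" and p: "\<And>v. v \<in> ?V \<Longrightarrow> p v = Unl (r v)" for p r e
    proof -
      obtain u w where uw: "e = {u, w}"
        using R \<open>e \<in> snd R\<close> unfolding wf_rep_def by (meson card_2_iff)
      then have V: "u \<in> ?V" "w \<in> ?V"
        using edge_subset[OF R \<open>e \<in> snd R\<close>] by auto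
      then have "i = r u \<and> j = r w \<or> i = r w \<and> j = r u"
        using that(1) p unfolding uw by (auto simp: doubleton_eq_iff)
      then show ?thesis
        using V uw \<open>e \<in> snd R\<close> by (metis insert_commute)
    qed
    from e show ?thesis
    proof
      assume "{Unl i, Unl j} \<in> (`) p1 ` snd R"
      then obtain d where d: "{Unl i, Unl j} = p1 ` d" "d \<in> snd R" by (rule imageE)
      show ?thesis using ex[OF d, of q1] q(1) by blast
    next
      assume "{Unl i, Unl j} \<in> (`) p2 ` snd R"
      then obtain d where d: "{Unl i, Unl j} = p2 ` d" "d \<in> snd R" by (rule imageE)
      show ?thesis using ex[OF d, of q2] q(2) by blast
    qed
  qed
  have adj_q: "adj (q1 u) (q1 w)" "adj (q2 u) (q2 w)" if "u \<in> ?V" "w \<in> ?V" "{u, w} \<in> snd R" for u w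
  proof -
    have "p1 ` {u, w} \<in> K55_edges - C10_edges" "p2 ` {u, w} \<in> K55_edges - C10_edges"
      using edges that(3) by blast+
    then show "adj (q1 u) (q1 w)" "adj (q2 u) (q2 w)"
      unfolding image_insert image_empty using q that(1,2) edge_iff_adj by metis+
  qed
  have "\<not> X (q1 v)"
  proof (rule no_swap[of \<sigma>])
    fix i j :: nat
    show "\<sigma> i < 10" "\<sigma> (\<sigma> i) = i" "\<sigma> i \<noteq> i \<longleftrightarrow> X i \<or> X (\<sigma> i)" if "i < 10"
    proof -
      obtain u where u: "u \<in> ?V" "i = q1 u \<or> i = q2 u"
        using cover[OF \<open>i < 10\<close>] by blast
      then show "\<sigma> i < 10" "\<sigma> (\<sigma> i) = i" "\<sigma> i \<noteq> i \<longleftrightarrow> X i \<or> X (\<sigma> i)"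
        using \<sigma>1[OF u(1)] \<sigma>2[OF u(1)] q[OF u(1)] X1[OF u(1)] X2[OF u(1)] q_eq(3)[OF u(1,1)] by auto
    qed
    assume "adj i j"
    then obtain u w where uw: "u \<in> ?V" "w \<in> ?V" "{u, w} \<in> snd R"
      "i = q1 u \<and> j = q1 w \<or> i = q2 u \<and> j = q2 w"
      using edge by blast
    then show "adj (\<sigma> i) (\<sigma> j)"
      using adj_q[OF uw(1-3)] \<sigma>1 \<sigma>2 by auto
    show "\<not> X (\<sigma> j)" if "X i"
      using uw that \<sigma>1 X2 by auto
  next
    show "q1 v < 10"
      using q v by blast
  qed
  then show False
    using X1 v None by blast
qed

lemma glue_rep_fully_labeled:
  assumes R: "wf_rep R" and lab: "\<forall>v\<in>fst R. label v \<noteq> None"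
  shows "glue_rep R R = R"
proof -
  have "map_rep (rename f) R = R" for f
    using lab rename_labeled by (intro map_rep_ident[OF R]) (auto simp: labeled_def)
  then show ?thesis
    by (simp add: glue_rep_def union_rep_def)
qed

lemma trivial_square_K55_minus_C10: "trivial_square K55_minus_C10"
  unfolding trivial_square_def
proof (intro conjI allI impI)
  have Q: "iso_rep (Unl ` {..<10}, K55_edges - C10_edges) (Unl ` {..<10}, K55_edges - C10_edges)"
    using wf_K55_minus_C10 iso_rep_refl by blast
  show "unlabeled K55_minus_C10"
    unfolding K55_minus_C10_def by (subst unlabeled.abs_eq[OF Q]) auto
  fix G
  assume G: "K55_minus_C10 = remove_labels (G + G)"
  obtain R where R: "wf_rep R" "G = abs_plgraph R"
    using plgraph_rep by metis
  have iso: "iso_rep R R" "iso_rep (glue_rep R R) (glue_rep R R)"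
    using R wf_glue_rep iso_rep_refl by blast+
  have sq: "remove_labels (G + G) = abs_plgraph (map_rep drop_label (glue_rep R R))"
    using iso R by (simp add: plus_plgraph.abs_eq remove_labels.abs_eq)
  then have "iso_rep (map_rep drop_label (glue_rep R R)) (Unl ` {..<10}, K55_edges - C10_edges)"
    using G R wf_K55_minus_C10 by (intro abs_plgraph_eqD wf_drop_label wf_glue_rep) (simp_all add: K55_minus_C10_def)
  then have lab: "\<forall>v\<in>fst R. label v \<noteq> None"
    using all_labeled_if_square[OF R(1)] by blast
  then show "fully_labeled G"
    using fully_labeled.abs_eq[OF iso(1)] R(2) by simp
  show "remove_labels G = K55_minus_C10"
    unfolding G sq glue_rep_fully_labeled[OF R(1) lab] unfolding R(2) by (rule remove_labels.abs_eq[OF iso(1)])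
qed

subsection \<open>Multiples of the binomial\<close>

lemma unlabeled_add: "unlabeled G \<Longrightarrow> unlabeled H \<Longrightarrow> unlabeled (G + H)"
  by transfer (auto simp: glue_rep_def union_rep_def map_rep_def)

lemma no_isolated_add: "no_isolated G \<Longrightarrow> no_isolated H \<Longrightarrow> no_isolated (G + H)"
proof transfer
  fix G H :: graph_rep
  assume GH: "\<forall>v\<in>fst G. \<exists>e\<in>snd G. v \<in> e" "\<forall>v\<in>fst H. \<exists>e\<in>snd H. v \<in> e"
  have "\<forall>v\<in>fst (map_rep h K). \<exists>e\<in>snd (map_rep h K). v \<in> e"
    if "\<forall>v\<in>fst K. \<exists>e\<in>snd K. v \<in> e" for h K
    using that unfolding map_rep_def by (simp, blast)
  with GH show "\<forall>v\<in>fst (glue_rep G H). \<exists>e\<in>snd (glue_rep G H). v \<in> e"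
    unfolding glue_rep_def union_rep_def fst_conv snd_conv by (metis Un_iff)
qed

lemma add_unlabeled:
  assumes "unlabeled G"
  shows vertex_count_add_unlabeled: "vertex_count (G + H) = vertex_count G + vertex_count H"
    and edge_count_add_unlabeled: "edge_count (G + H) = edge_count G + edge_count H"
proof -
  obtain R R' where R: "wf_rep R" "G = abs_plgraph R" "wf_rep R'" "H = abs_plgraph R'"
    using plgraph_rep by metis
  have "labeled R = {}"
    using assms R(1) unfolding R(2) labeled_def by (simp add: unlabeled.abs_eq iso_rep_refl)
  moreover have "labeled_edges R = {}"
    using \<open>labeled R = {}\<close> R(1) by (auto simp: labeled_edges_def wf_rep_def)
  ultimately show "vertex_count (G + H) = vertex_count G + vertex_count H" "edge_count (G + H) = edge_count G + edge_count H"
    using vertex_count_abs[OF R(1,3)] edge_count_abs[OF R(1,3)] R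
    by (simp_all add: vertex_count.abs_eq edge_count.abs_eq iso_rep_refl)
qed

lemma eq_zero_if_vertex_count:
  assumes "vertex_count G = 0"
  shows "G = 0"
proof -
  obtain R where R: "wf_rep R" "G = abs_plgraph R"
    using plgraph_rep by metis
  then have "fst R = {}"
    using assms finite_vertices by (simp add: vertex_count.abs_eq iso_rep_refl)
  moreover have "snd R = {}"
    using R(1) \<open>fst R = {}\<close> by (auto simp: wf_rep_def)
  ultimately show ?thesis
    unfolding R(2) zero_plgraph_def by (metis prod.collapse)
qed

lemma eq_zero_if_edge_count:
  assumes "edge_count G = 0" "no_isolated G"
  shows "G = 0"
proof -
  obtain R where R: "wf_rep R" "G = abs_plgraph R"
    using plgraph_rep by metis
  then have "snd R = {}"
    using assms finite_edges by (simp add: edge_count.abs_eq iso_rep_refl)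
  then have "fst R = {}"
    using assms(2) R by (auto simp: no_isolated.abs_eq iso_rep_refl)
  then show ?thesis
    using R finite_vertices by (intro eq_zero_if_vertex_count) (simp add: vertex_count.abs_eq iso_rep_refl)
qed

text \<open>Convexity of the vertex count makes both squares empty, and a factor has no more
  vertices than its square. Thus only the empty graph contributes to the constant term of a
  square.\<close>

lemma remove_labels_add_eq_zero:
  assumes "remove_labels (G + H) = 0"
  shows "G = 0" "H = 0"
proof -
  have vertex_count_0: "vertex_count 0 = 0"
    by transfer simp
  then have "vertex_count (G + H) = 0"
    using assms vertex_count_remove_labels[of "G + H"] by simp
  then have "vertex_count (G + G) = 0" "vertex_count (H + H) = 0"
    using vertex_count_convex[of G H] by auto
  moreover have "vertex_count K \<le> vertex_count (K + K)" for K
  proof -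
    obtain R where R: "wf_rep R" "K = abs_plgraph R"
      using plgraph_rep by metis
    then show ?thesis
      using vertex_count_abs[OF R(1,1)] card_mono[OF finite_vertices[OF R(1)] labeled_subset[of R]]
      by (simp add: vertex_count.abs_eq iso_rep_refl)
  qed
  ultimately show "G = 0" "H = 0"
    using eq_zero_if_vertex_count by (metis le_zero_eq)+
qed

lemma of_graph_power: "of_graph G ^ n = of_graph (\<Sum>i<n. G)"
  by (induction n) (simp_all add: of_graph_def mult_single single_one add.commute)

lemma edge_graph_props: "edge_count edge_graph = 1" "vertex_count edge_graph = 2" "unlabeled edge_graph" "no_isolated edge_graph"
  by (transfer, simp)+

lemma edges_props:
  fixes n :: nat
  defines "E \<equiv> \<Sum>i<n. edge_graph"
  shows "edge_count E = n" "vertex_count E = 2 * n" "unlabeled E" "no_isolated E"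
proof -
  have 0: "edge_count 0 = 0" "vertex_count 0 = 0" "unlabeled 0" "no_isolated 0"
    by (transfer, simp)+
  show "unlabeled E" "no_isolated E"
    unfolding E_def by (induction n) (simp_all add: 0 unlabeled_add no_isolated_add edge_graph_props)
  show "edge_count E = n" "vertex_count E = 2 * n"
    unfolding E_def
    by (induction n) (simp_all add: 0 add.commute[of _ edge_graph] vertex_count_add_unlabeled edge_count_add_unlabeled edge_graph_props)
qed

lemma K55_minus_C10_props: "edge_count K55_minus_C10 = 15" "vertex_count K55_minus_C10 = 10" "unlabeled K55_minus_C10"
  "no_isolated K55_minus_C10"
proof -
  show "edge_count K55_minus_C10 = 15"
    by transfer (simp add: card_K55_minus_C10_edges)
  show "vertex_count K55_minus_C10 = 10"
    by transfer (simp add: card_image inj_on_def)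
  show "unlabeled K55_minus_C10"
    by transfer auto
  have "adj i ((i + 5) mod 10)" if "i < 10" for i
    using that adj_rotate[of 0 5 i] by (simp add: adj_def add.commute)
  then have "\<forall>v\<in>Unl ` {..<10}. \<exists>e\<in>K55_edges - C10_edges. v \<in> e"
    using edge_iff_adj by blast
  then show "no_isolated K55_minus_C10"
    by transfer simp
qed

text \<open>A nonempty graph without isolated vertices has an edge, so multiplying \<open>Q\<close>
  by it exceeds the edge count of \<open>Q\<close>; only the constant term of \<open>p\<close> is
  seen.\<close>

lemma lookup_of_graph_mult:
  assumes Q: "unlabeled Q" and p: "p \<in> unlabeled_combs" and F: "edge_count F \<le> edge_count Q"
  shows "Poly_Mapping.lookup (of_graph Q * p) F = (Poly_Mapping.lookup p 0 when Q = F)"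
proof -
  have "of_graph Q * p = (\<Sum>K\<in>Poly_Mapping.keys p. Poly_Mapping.single (Q + K) (Poly_Mapping.lookup p K))"
    by (subst sum_single_lookup[of p, symmetric])
      (simp only: of_graph_def sum_distrib_left mult_single mult_1)
  then have "Poly_Mapping.lookup (of_graph Q * p) F =
      (\<Sum>K\<in>Poly_Mapping.keys p. (Poly_Mapping.lookup p K when Q + K = F))"
    by (simp add: lookup_sum lookup_single)
  also have "\<dots> = (\<Sum>K\<in>{0}. (Poly_Mapping.lookup p K when Q + K = F))"
  proof (rule sum.mono_neutral_cong)
    fix K
    assume K: "K \<in> Poly_Mapping.keys p - {0}"
    then have "edge_count K \<noteq> 0"
      using p eq_zero_if_edge_count by (auto simp: unlabeled_combs_def combs_def)
    then show "(Poly_Mapping.lookup p K when Q + K = F) = 0"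
      using F edge_count_add_unlabeled[OF Q, of K] by (auto simp: when_def)
  qed (auto simp: in_keys_iff when_def)
  finally show ?thesis
    by simp
qed

text \<open>It ensures that \<open>1 + g\<close> has a positive constant term.\<close>

lemma lookup_sos_zero_nonneg:
  assumes "is_sos g"
  shows "0 \<le> Poly_Mapping.lookup g 0"
proof -
  obtain as where "g = (\<Sum>a\<leftarrow>as. unlabel (a\<^sup>2))"
    using assms by (auto simp: is_sos_def)
  moreover have "0 \<le> Poly_Mapping.lookup (unlabel (a\<^sup>2)) 0" for a
    by (rule lookup_unlabel_square_nonneg) (metis remove_labels_add_eq_zero)
  ultimately show ?thesis
    by (auto simp: lookup_sum_list intro!: sum_list_nonneg)
qed

text \<open>Up to the common edge count the product is a positive multiple of the binomial, so its
  coefficient at \<open>E\<close> is negative, against \<open>squares_coeff_zero\<close>. The factor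
  \<open>p\<close> covers both 1 and \<open>1 + g\<close>.\<close>

lemma not_sos_mult:
  assumes H: "trivial_square H" and E: "unlabeled E" "edge_count E = edge_count H" "E \<noteq> H"
    and p: "p \<in> unlabeled_combs" "0 < Poly_Mapping.lookup p 0"
  shows "\<not> is_sos ((of_graph H - of_graph E) * p)"
proof
  let ?f = "(of_graph H - of_graph E) * p"
  assume "is_sos ?f"
  then obtain as where as: "set as \<subseteq> combs" "?f = (\<Sum>a\<leftarrow>as. unlabel (a\<^sup>2))"
    by (auto simp: is_sos_def)
  have "unlabeled H"
    using H by (simp add: trivial_square_def)
  then have lookup: "Poly_Mapping.lookup ?f F =
      (Poly_Mapping.lookup p 0 when H = F) - (Poly_Mapping.lookup p 0 when E = F)" if "edge_count F \<le> edge_count H" for F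
    using lookup_of_graph_mult[OF _ p(1), of H F] lookup_of_graph_mult[OF E(1) p(1), of F] that E(2)
    by (simp add: left_diff_distrib lookup_minus)
  have "Poly_Mapping.lookup ?f E = 0"
  proof (rule squares_coeff_zero[OF as H refl])
    show "Poly_Mapping.lookup ?f F \<le> 0" if "edge_count F \<le> edge_count H" "F \<noteq> H" for F
      using lookup[OF that(1)] that(2) p(2) by (simp add: when_def)
  qed (use E in auto)
  then show False
    using lookup[of E] E p(2) by (simp add: when_def)
qed

theorem corollary1p5:
  shows "trivial_square K55_minus_C10
    \<and> of_graph K55_minus_C10 - of_graph edge_graph ^ 15 \<in> unlabeled_combs
    \<and> \<not> is_sos (of_graph K55_minus_C10 - of_graph edge_graph ^ 15)
    \<and> \<not> (\<exists>g\<in>unlabeled_combs. is_sos g \<and>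
          is_sos ((of_graph K55_minus_C10 - of_graph edge_graph ^ 15) * (1 + g)))"
proof -
  let ?H = K55_minus_C10 and ?E = "\<Sum>i<15::nat. edge_graph"
  \<comment> \<open>Both have 15 edges, but the disjoint edges have 30 vertices and the other graph
    only 10.\<close>
  have "?E \<noteq> ?H"
    using edges_props(2)[of 15] K55_minus_C10_props(2) by auto
  then have not_sos: "\<not> is_sos ((of_graph ?H - of_graph ?E) * p)"
    if "p \<in> unlabeled_combs" "0 < Poly_Mapping.lookup p 0" for p
    using that K55_minus_C10_props edges_props[of 15] trivial_square_K55_minus_C10
    by (intro not_sos_mult) auto
  have keys_one: "Poly_Mapping.keys (1 :: graph_comb) \<subseteq> {0}"
    by simp
  have zero: "no_isolated 0" "unlabeled 0"
    by (transfer, simp)+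
  then have "1 \<in> unlabeled_combs"
    using keys_one by (auto simp: unlabeled_combs_def combs_def)
  then have "\<not> is_sos (of_graph ?H - of_graph ?E)"
    using not_sos[of 1] by (simp add: lookup_one)
  moreover have "\<not> is_sos ((of_graph ?H - of_graph ?E) * (1 + g))" if g: "g \<in> unlabeled_combs" "is_sos g" for g
  proof (rule not_sos)
    have "Poly_Mapping.keys (1 + g) \<subseteq> insert 0 (Poly_Mapping.keys g)"
      using Poly_Mapping.keys_add[of 1 g] keys_one by blast
    then show "1 + g \<in> unlabeled_combs"
      using g(1) zero by (auto simp: unlabeled_combs_def combs_def)
    show "0 < Poly_Mapping.lookup (1 + g) 0"
      using lookup_sos_zero_nonneg[OF g(2)] by (simp add: lookup_add lookup_one)
  qed
  moreover have "of_graph ?H - of_graph ?E \<in> unlabeled_combs"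
    using keys_diff[of "of_graph ?H" "of_graph ?E"] K55_minus_C10_props edges_props[of 15]
    by (auto simp: unlabeled_combs_def combs_def of_graph_def)
  ultimately show ?thesis
    using trivial_square_K55_minus_C10 unfolding of_graph_power by blast
qed

end
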